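(* For $n\ge1$, let $g(n)$ be the maximum $g\in[0,1]$ such that for every cutting $P$ of the pizza into $n$ slices, Alice has a strategy with gain $g|P|$. Then $$g(n)=\begin{cases}1 & \text{if } n=1,\\ 4/9 & \text{if } n\in\{15,17,19,\dots\},\\ 1/2 & \text{otherwise.}\end{cases}$$ Moreover, for every cutting into $n$ slices, Alice has a zero-jump strategy with gain $g(n)|P|$ when $n$ is even or $n\le 7$, a one-jump strategy with gain $g(n)|P|$ when $n\in\{9,11,13\}$, and a two-jump strategy with gain $g(n)|P|$ when $n\in\{15,17,19,\dots\}$.
   Context: The pizza game: a pizza is cut into $n\ge1$ slices forming a circular sequence $P=p_0p_1\dots p_{n-1}$ (indices modulo $n$, $p_i$ adjacent to $p_{i\pm1}$), each slice having a size $|p_i|\ge 0$; $|P|=\sum_i|p_i|$. Alice and Bob alternately take slices, one per turn, Alice first. In the first turn Alice may take any slice; in every later turn the player must take a slice that has a neighbor already taken. For $1<j\le n$, if a player took $p_i$ in turn $j-1$ and the other player takes $p_{i-1}$ or $p_{i+1}$ in turn $j$, turn $j$ is a shift; otherwise it is a jump. A strategy of a player is a $j$-jump strategy if it makes at most $j$ jumps of that player. A strategy has gain $g$ if it guarantees the player a set of slices of total size at least $g$, whatever the opponent does. *)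

theory Defs
  imports Complex_Main
begin

text \<open>
  Slices are the indices \<open>0, \<dots>, n - 1\<close>, read cyclically; only the sizes \<open>P i\<close>
  with \<open>i < n\<close> matter. A (partial) play is the list of slices taken so far,
  in order. List positions count turns from 0, so Alice moves at the even positions.
\<close>

definition cutting :: "nat \<Rightarrow> (nat \<Rightarrow> real) \<Rightarrow> bool" where
  "cutting n P \<longleftrightarrow> (\<forall>i<n. 0 \<le> P i)"

definition pizza_size :: "nat \<Rightarrow> (nat \<Rightarrow> real) \<Rightarrow> real" where
  "pizza_size n P = (\<Sum>i<n. P i)"

definition adjacent :: "nat \<Rightarrow> nat \<Rightarrow> nat \<Rightarrow> bool" where
  "adjacent n i j \<longleftrightarrow> j = (i + 1) mod n \<or> i = (j + 1) mod n"

definition legal_move :: "nat \<Rightarrow> nat list \<Rightarrow> nat \<Rightarrow> bool" where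
  "legal_move n h i \<longleftrightarrow>
     i < n \<and> i \<notin> set h \<and> (h = [] \<or> (\<exists>k\<in>set h. adjacent n k i))"

definition legal_play :: "nat \<Rightarrow> nat list \<Rightarrow> bool" where
  "legal_play n h \<longleftrightarrow> (\<forall>t<length h. legal_move n (take t h) (h ! t))"

type_synonym strategy = "nat list \<Rightarrow> nat"

text \<open>Strategies are required to answer legally, so that the universal statements over
  the plays following a strategy below are never vacuous.\<close>

definition alice_strategy :: "nat \<Rightarrow> strategy \<Rightarrow> bool" where
  "alice_strategy n s \<longleftrightarrow>
     (\<forall>h. legal_play n h \<and> length h < n \<and> even (length h) \<longrightarrow> legal_move n h (s h))"

definition alice_follows :: "strategy \<Rightarrow> nat list \<Rightarrow> bool" where
  "alice_follows s h \<longleftrightarrow> (\<forall>t<length h. even t \<longrightarrow> h ! t = s (take t h))"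

definition outcomes :: "nat \<Rightarrow> strategy \<Rightarrow> nat list set" where
  "outcomes n s = {h. legal_play n h \<and> length h = n \<and> alice_follows s h}"

definition alice_total :: "(nat \<Rightarrow> real) \<Rightarrow> nat list \<Rightarrow> real" where
  "alice_total P h = (\<Sum>t | t < length h \<and> even t. P (h ! t))"

text \<open>The very first turn is neither a shift nor a jump.\<close>

definition is_jump :: "nat \<Rightarrow> nat list \<Rightarrow> nat \<Rightarrow> bool" where
  "is_jump n h t \<longleftrightarrow> 0 < t \<and> t < length h \<and> \<not> adjacent n (h ! (t - 1)) (h ! t)"

definition alice_jumps :: "nat \<Rightarrow> nat list \<Rightarrow> nat" where
  "alice_jumps n h = card {t. even t \<and> is_jump n h t}"

definition has_gain :: "nat \<Rightarrow> (nat \<Rightarrow> real) \<Rightarrow> strategy \<Rightarrow> real \<Rightarrow> bool" where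
  "has_gain n P s x \<longleftrightarrow> (\<forall>h\<in>outcomes n s. x \<le> alice_total P h)"

definition jump_strategy :: "nat \<Rightarrow> nat \<Rightarrow> strategy \<Rightarrow> bool" where
  "jump_strategy n j s \<longleftrightarrow> alice_strategy n s \<and> (\<forall>h\<in>outcomes n s. alice_jumps n h \<le> j)"

definition guaranteed :: "nat \<Rightarrow> real set" where
  "guaranteed n = {x \<in> {0..1}. \<forall>P. cutting n P \<longrightarrow>
     (\<exists>s. alice_strategy n s \<and> has_gain n P s (x * pizza_size n P))}"

text \<open>Meaningful only if the maximum is attained, which has to be established separately.\<close>

definition pizza_gain :: "nat \<Rightarrow> real" where
  "pizza_gain n = (GREATEST x. x \<in> guaranteed n)"

end

theory Submission
  imports Defs
begin

text \<open>
  After each of Alice's turns the untaken slices form an arc, so a position is such an arc together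
  with the number of jumps she has left.

  For even \<open>n\<close>, Alice takes the heavier colour class of an alternating colouring.

  For odd \<open>n\<close>, Alice always shifting from slice \<open>z\<close> ends up with a \<^emph>\<open>half circle\<close> containing \<open>z\<close>: the slices
  \<open>y, y + 2, \<dots>, y + n - 1\<close> for some gap \<open>y\<close>. If no slice is good in this sense, then there are three gaps
  with light half circles that cut the circle into blocks of odd lengths \<open>2 * L\<^sub>i + 1\<close>. In a
  cut of minimal total size, the even slices of every block outweigh its odd ones, on each
  prefix and each suffix of even length. The weights of the odd and even slices of
  the blocks are \<open>e, b\<close>, then \<open>c, f\<close>, then \<open>a, d\<close>; the half circles weigh \<open>e + f + a\<close>, \<open>c + d + e\<close>
  and \<open>a + b + c\<close>. If all are below half of the pizza then \<open>a < d\<close>, \<open>c < f\<close> and \<open>e < b\<close>, so every block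
  has an even slice and \<open>n \<ge> 9\<close>.

  Alice starts with an even slice of the first block and shifts until Bob takes an end of this block; then she
  jumps to the opposite side of the eaten part and shifts for the rest of the game. Outside the block
  she gets \<open>min (c + d) (f + a)\<close>. If \<open>L\<^sub>1 = 1\<close> this
  gives half of the pizza, and some \<open>L\<^sub>i = 1\<close> if \<open>n \<le> 13\<close>. In general she gets
  \<open>b / 2 + e / 4\<close> inside the block, if necessary by starting with
  the weighted median of the odd slices and jumping to the even ones later, which costs a second jump. A linear
  programming argument shows that one of the three blocks then yields \<open>4 / 9\<close>.

  Conversely, \<open>1/2\<close> is optimal for two adjacent slices of size 1, and \<open>4/9\<close> for the cutting
  \<open>2 0 2 0 0 1 0 1 0 0 1 0 2 0 \<dots> 0\<close>: after at most three more turns Bob is content with one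
  of the two colours of the remaining arc.
\<close>

section \<open>Plays and strategies\<close>

lemma legal_play_append:
  "legal_play n (h @ [x]) \<longleftrightarrow> legal_play n h \<and> legal_move n h x"
  unfolding legal_play_def by (auto simp: nth_append less_Suc_eq)

lemma legal_play_Nil [simp]: "legal_play n []"
  by (simp add: legal_play_def)

lemma legal_play_take: "legal_play n h \<Longrightarrow> legal_play n (take t h)"
  unfolding legal_play_def by (auto simp: min_def)

lemma legal_play_set: "legal_play n h \<Longrightarrow> set h \<subseteq> {..<n} \<and> distinct h"
  by (induction h rule: rev_induct) (auto simp: legal_play_append legal_move_def)

text \<open>If no slice were playable, the taken ones would be closed under the successor modulo
  \<open>n\<close> and hence fill the circle, against the length bound.\<close>

lemma legal_move_exists:
  assumes "legal_play n h" "length h < n"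
  shows "\<exists>i. legal_move n h i"
proof (cases "h = []")
  case True
  then show ?thesis using assms by (auto simp: legal_move_def)
next
  case False
  have h: "set h \<subseteq> {..<n}" "distinct h" using legal_play_set[OF assms(1)] by auto
  show ?thesis
  proof (rule ccontr)
    assume neg: "\<nexists>i. legal_move n h i"
    have step: "(k + 1) mod n \<in> set h" if "k \<in> set h" for k
    proof (rule ccontr)
      assume "(k + 1) mod n \<notin> set h"
      then have "legal_move n h ((k + 1) mod n)"
        using that assms(2) by (auto simp: legal_move_def adjacent_def)
      then show False using neg by blast
    qed
    obtain k where k: "k \<in> set h" using False by (cases h) auto
    have all: "(k + i) mod n \<in> set h" for i
    proof (induction i)
      case 0 then show ?case using k h(1) by auto
    next
      case (Suc i)
      from step[OF this] show ?case by (simp add: mod_simps)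
    qed
    have "{..<n} \<subseteq> set h"
    proof
      fix j assume "j \<in> {..<n}"
      then have j: "j < n" by simp
      have "k mod n < n" "k = n * (k div n) + k mod n" using j by simp_all
      then have "k + (n - k mod n + j) = n * (k div n) + n + j" by linarith
      also have "\<dots> mod n = j" using j by (simp add: add.assoc)
      finally have "(k + (n - k mod n + j)) mod n = j" .
      then show "j \<in> set h" using all by metis
    qed
    then have "n \<le> card (set h)" by (metis List.finite_set card_lessThan card_mono)
    then show False using assms(2) card_length[of h] by linarith
  qed
qed

lemma alice_total_append:
  "alice_total P (h @ [x]) = alice_total P h + (if even (length h) then P x else 0)"
proof -
  have *: "{t. t < length (h @ [x]) \<and> even t} =
    (if even (length h) then insert (length h) {t. t < length h \<and> even t}
     else {t. t < length h \<and> even t})"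
    by (auto simp: less_Suc_eq)
  have "(\<Sum>t | t < length h \<and> even t. P ((h @ [x]) ! t)) = alice_total P h"
    unfolding alice_total_def by (intro sum.cong) (auto simp: nth_append)
  then show ?thesis
    unfolding alice_total_def[of P "h @ [x]"] * by (simp add: sum.insert)
qed

lemma alice_jumps_append:
  "alice_jumps n (h @ [x]) = alice_jumps n h +
     (if even (length h) \<and> h \<noteq> [] \<and> \<not> adjacent n (last h) x then 1 else 0)"
proof -
  let ?J = "\<lambda>h. {t. even t \<and> is_jump n h t}"
  have fin: "finite (?J h)"
    by (rule finite_subset[of _ "{..<length h}"]) (auto simp: is_jump_def)
  have "?J (h @ [x]) = (if even (length h) \<and> h \<noteq> [] \<and> \<not> adjacent n (last h) x
      then insert (length h) (?J h) else ?J h)"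
  proof (cases "h = []")
    case True
    then show ?thesis by (auto simp: is_jump_def)
  next
    case False
    then have "length h - 1 < length h" "last h = h ! (length h - 1)"
      by (simp_all add: last_conv_nth)
    then show ?thesis using False
      by (auto simp: is_jump_def nth_append less_Suc_eq)
  qed
  moreover have "length h \<notin> ?J h" by (auto simp: is_jump_def)
  ultimately show ?thesis unfolding alice_jumps_def using fin by simp
qed

text \<open>For even \<open>n\<close> the final turn is Bob's; the outcome can thus be read off
  after Alice's last turn, where the invariants below are stated.\<close>

lemma last_move_of_Bob:
  assumes "even (length h)"
  shows "alice_total P (butlast h) = alice_total P h" "alice_jumps n (butlast h) = alice_jumps n h"
  using assms alice_total_append[of P "butlast h" "last h"] alice_jumps_append[of n "butlast h" "last h"]
  by (cases "h = []"; auto)+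

text \<open>Alice's invariant method: \<open>Q\<close> refers to odd lengths, just after her turns,
  and her strategy picks any legal slice that restores it.\<close>

lemma strategy_from_invariant:
  assumes start: "legal_move n [] z" "Q [z]"
    and step: "\<And>h b. legal_play n h \<Longrightarrow> odd (length h) \<Longrightarrow> Q h \<Longrightarrow> legal_move n h b \<Longrightarrow>
      Suc (length h) < n \<Longrightarrow> \<exists>i. legal_move n (h @ [b]) i \<and> Q (h @ [b, i])"
  shows "\<exists>s. alice_strategy n s \<and> (\<forall>h\<in>outcomes n s. \<forall>t\<le>n. odd t \<longrightarrow> Q (take t h))"
proof -
  \<comment> \<open>The second \<open>SOME\<close> is a default for histories in which
    \<open>Q\<close> cannot be restored: \<open>alice_strategy\<close> asks for a legal answer after
    every legal play, not only after those that follow \<open>s\<close>.\<close>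
  define s where "s h = (if \<exists>i. legal_move n h i \<and> Q (h @ [i])
    then SOME i. legal_move n h i \<and> Q (h @ [i]) else SOME i. legal_move n h i)" for h
  have sQ: "legal_move n h (s h) \<and> Q (h @ [s h])" if "\<exists>i. legal_move n h i \<and> Q (h @ [i])" for h
    using someI_ex[OF that] that by (simp add: s_def)
  have "alice_strategy n s"
    unfolding alice_strategy_def
  proof (intro allI impI)
    fix h assume h: "legal_play n h \<and> length h < n \<and> even (length h)"
    show "legal_move n h (s h)"
    proof (cases "\<exists>i. legal_move n h i \<and> Q (h @ [i])")
      case True then show ?thesis using sQ by blast
    next
      case False
      then have "s h = (SOME i. legal_move n h i)" unfolding s_def by (rule if_not_P)
      then show ?thesis using legal_move_exists[of n h] h by (metis someI_ex)
    qed
  qed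
  moreover have "Q (take (2 * k + 1) h)" if h: "h \<in> outcomes n s" and "2 * k + 1 \<le> n" for h k
    using that(2)
  proof (induction k)
    case 0
    have "h ! 0 = s (take 0 h)" "length h = n"
      using h 0 unfolding outcomes_def alice_follows_def by auto
    then have "take (2 * 0 + 1) h = [] @ [s []]"
      using 0 by (cases h) auto
    then show ?case using sQ[of "[]"] start by auto
  next
    case (Suc k)
    define g where "g = take (2 * k + 1) h"
    have lh: "length h = n" "legal_play n h" using h by (auto simp: outcomes_def)
    have lg: "length g = 2 * k + 1" using Suc.prems lh by (simp add: g_def)
    have Qg: "Q g" using Suc by (simp add: g_def)
    define b where "b = h ! (2 * k + 1)"
    have tb: "take (2 * k + 2) h = g @ [b]"
      using Suc.prems lh by (simp add: g_def b_def take_Suc_conv_app_nth)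
    have "legal_play n (g @ [b])" using legal_play_take[OF lh(2), of "2*k+2"] tb by simp
    then have "legal_play n g" "legal_move n g b" by (auto simp: legal_play_append)
    then have "\<exists>i. legal_move n (g @ [b]) i \<and> Q (g @ [b, i])"
      using step[of g b] Qg lg Suc.prems by simp
    then have "Q ((g @ [b]) @ [s (g @ [b])])" using sQ[of "g @ [b]"] by simp
    moreover have "h ! (2 * k + 2) = s (take (2 * k + 2) h)"
    proof -
      have "\<forall>t<length h. even t \<longrightarrow> h ! t = s (take t h)"
        using h unfolding outcomes_def alice_follows_def by blast
      moreover have "2 * k + 2 < length h" "even (2 * k + 2)" using Suc.prems lh by auto
      ultimately show ?thesis by blast
    qed
    moreover have "take (2 * Suc k + 1) h = take (2 * k + 2) h @ [h ! (2 * k + 2)]"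
    proof -
      have "2 * k + 2 < length h" using Suc.prems lh by simp
      from take_Suc_conv_app_nth[OF this] show ?thesis by simp
    qed
    ultimately show ?case using tb by simp
  qed
  ultimately show ?thesis by (metis oddE)
qed

text \<open>Bob's counterpart: his moves are built along one play against the given
  \<open>s\<close>, so he needs no strategy as an object. For even \<open>n\<close> he also makes
  the last turn, after which \<open>Q\<close> is not claimed; hence \<open>butlast\<close>.\<close>

lemma play_from_invariant:
  assumes s: "alice_strategy n s" and n: "n \<ge> 1"
    and start: "\<And>z. legal_move n [] z \<Longrightarrow> Q [z]"
    and step: "\<And>h. legal_play n h \<Longrightarrow> odd (length h) \<Longrightarrow> Q h \<Longrightarrow> length h < n \<Longrightarrow>
      \<exists>b. legal_move n h b \<and> (\<forall>i. legal_move n (h @ [b]) i \<longrightarrow> Q (h @ [b, i]))"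
  obtains h where "h \<in> outcomes n s" "Q (if odd n then h else butlast h)"
proof -
  have ext: "alice_follows s (h @ [x]) \<longleftrightarrow> alice_follows s h \<and> (even (length h) \<longrightarrow> x = s h)" for h x
    unfolding alice_follows_def by (auto simp: nth_append less_Suc_eq)
  have sl: "legal_move n h (s h)" if "legal_play n h" "length h < n" "even (length h)" for h
    using s that unfolding alice_strategy_def by blast
  have *: "\<exists>h. legal_play n h \<and> length h = 2 * k + 1 \<and> alice_follows s h \<and> Q h" if "2 * k + 1 \<le> n" for k
    using that
  proof (induction k)
    case 0
    have "legal_move n [] (s [])" using sl[of "[]"] n by simp
    then show ?case
      using start legal_play_append[of n "[]"] ext[of "[]"]
      by (intro exI[of _ "[s []]"]) (auto simp: alice_follows_def)
  next
    case (Suc k)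
    then obtain h where h: "legal_play n h" "length h = 2 * k + 1" "alice_follows s h" "Q h"
      by auto
    obtain b where b: "legal_move n h b" "\<And>i. legal_move n (h @ [b]) i \<Longrightarrow> Q (h @ [b, i])"
      using step[of h] h Suc.prems by auto
    have hb: "legal_play n (h @ [b])" using h b by (simp add: legal_play_append)
    have m: "legal_move n (h @ [b]) (s (h @ [b]))" using sl[OF hb] h Suc.prems by simp
    have "legal_play n ((h @ [b]) @ [s (h @ [b])])" using hb m by (simp only: legal_play_append)
    moreover have "alice_follows s ((h @ [b]) @ [s (h @ [b])])"
      using h ext[of "h @ [b]"] ext[of h] by simp
    ultimately show ?case using b(2)[OF m] h
      by (intro exI[of _ "(h @ [b]) @ [s (h @ [b])]"]) simp
  qed
  show ?thesis
  proof (cases "odd n")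
    case True
    then obtain k where "n = 2 * k + 1" by (auto elim: oddE)
    then show ?thesis using * True that by (fastforce simp: outcomes_def)
  next
    case False
    then obtain q where "n = 2 * q" by blast
    then have k: "n = 2 * (q - 1) + 2" using n by simp
    define k where "k = q - 1"
    have k: "n = 2 * k + 2" using k by (simp add: k_def)
    then have "2 * k + 1 \<le> n" by simp
    from *[OF this] obtain h
      where h: "legal_play n h" "length h = 2 * k + 1" "alice_follows s h" "Q h" by blast
    obtain b where b: "legal_move n h b" using legal_move_exists[of n h] h k by auto
    have "h @ [b] \<in> outcomes n s"
      using h b ext[of h] k by (simp add: outcomes_def legal_play_append)
    then show ?thesis using that[of "h @ [b]"] False h by simp
  qed
qed

section \<open>The untaken slices\<close>

text \<open>The start \<open>l\<close> is not reduced modulo \<open>n\<close>, so arcs that pass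
  slice 0 need no case distinction.\<close>

definition untaken :: "nat \<Rightarrow> nat list \<Rightarrow> nat \<Rightarrow> nat \<Rightarrow> bool" where
  "untaken n h l r \<longleftrightarrow> length h + r = n \<and> set h \<subseteq> {..<n}
     \<and> {..<n} - set h = (\<lambda>k. (l + k) mod n) ` {..<r}"

lemma mod_add_inj:
  fixes l i j n :: nat
  assumes "(l + i) mod n = (l + j) mod n" "i < n" "j < n"
  shows "i = j"
proof -
  have "i' = j'" if "i' \<le> j'" "(l + i') mod n = (l + j') mod n" "j' < n" for i' j'
  proof -
    have "n dvd (l + j') - (l + i')" using that by (metis add_le_cancel_left mod_eq_dvd_iff_nat)
    then have "n dvd j' - i'" by simp
    moreover have "j' - i' < n" using that by linarith
    ultimately have "j' - i' = 0" using nat_dvd_not_less by blast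
    then show ?thesis using that by simp
  qed
  from this[of i j] this[of j i] show ?thesis using assms by (metis nat_le_linear)
qed

lemma untaken_start:
  assumes "z < n"
  shows "untaken n [z] (z + 1) (n - 1)"
proof -
  have "j \<in> (\<lambda>k. (z + 1 + k) mod n) ` {..<n - 1}" if "j < n" "j \<noteq> z" for j
  proof (cases "z < j")
    case True
    then show ?thesis using that by (intro image_eqI[of _ _ "j - z - 1"]) auto
  next
    case False
    then have "z + 1 + (j + n - z - 1) = j + n" "j + n - z - 1 < n - 1" using that assms by auto
    then show ?thesis using that by (intro image_eqI[of _ _ "j + n - z - 1"]) auto
  qed
  moreover have "(z + 1 + k) mod n \<noteq> z" if "k < n - 1" for k
  proof
    assume "(z + 1 + k) mod n = z"
    then have "(z + (1 + k)) mod n = (z + 0) mod n" using assms by (simp add: add.assoc)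
    moreover have "1 + k < n" "0 < n" using that by linarith+
    ultimately show False using mod_add_inj[of z "1 + k" n 0] by simp
  qed
  ultimately have "{..<n} - {z} = (\<lambda>k. (z + 1 + k) mod n) ` {..<n - 1}"
    using assms by auto
  then show ?thesis using assms by (simp add: untaken_def)
qed

text \<open>An inner slice of the arc has both neighbours untaken, so only the ends are
  playable.\<close>

lemma untaken_legal_cases:
  assumes "untaken n h l (Suc r)" "h \<noteq> []" "legal_move n h i"
  shows "i = l mod n \<or> i = (l + r) mod n"
proof -
  have n: "Suc r < n" using assms by (cases h) (auto simp: untaken_def)
  have sub: "set h \<subseteq> {..<n}" and eq: "{..<n} - set h = (\<lambda>k. (l + k) mod n) ` {..<Suc r}"
    using assms by (auto simp: untaken_def)
  have "i \<in> {..<n} - set h" using assms by (simp add: legal_move_def)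
  then obtain k where k: "i = (l + k) mod n" "k < Suc r" using eq by auto
  obtain j where j: "j \<in> set h" "adjacent n j i"
    using assms by (auto simp: legal_move_def)
  have un: "(l + k') mod n \<notin> set h" if "k' < Suc r" for k'
    using eq that by blast
  from j(2) consider "i = (j + 1) mod n" | "j = (i + 1) mod n" by (auto simp: adjacent_def)
  then show ?thesis
  proof cases
    case 1
    show ?thesis
    proof (cases k)
      case 0 then show ?thesis using k by simp
    next
      case (Suc k')
      have "(1 + j) mod n = (1 + (l + k')) mod n" using 1 k Suc by (simp add: ac_simps)
      also have "\<dots> = (1 + (l + k') mod n) mod n" by (simp add: mod_simps)
      finally have "j = (l + k') mod n"
        using mod_add_inj[of 1 j n "(l + k') mod n"] sub j(1) n by auto
      then show ?thesis using un[of k'] k Suc j by simp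
    qed
  next
    case 2
    then have "j = (l + Suc k) mod n" using k by (simp add: mod_simps)
    then have "\<not> Suc k < Suc r" using un j by blast
    then show ?thesis using k by (simp add: less_Suc_eq)
  qed
qed

lemma untaken_take_left:
  assumes "untaken n h l (Suc r)" "h \<noteq> []"
  shows "legal_move n h (l mod n)" "untaken n (h @ [l mod n]) (l + 1) r"
proof -
  have n: "Suc r < n" using assms by (cases h) (auto simp: untaken_def)
  have sub: "set h \<subseteq> {..<n}" and eq: "{..<n} - set h = (\<lambda>k. (l + k) mod n) ` {..<Suc r}"
    using assms by (auto simp: untaken_def)
  have *: "(l + k) mod n \<noteq> l mod n" if "0 < k" "k < n" for k
    using mod_add_inj[of l k n 0] that by auto
  have "l mod n \<in> {..<n} - set h" unfolding eq by (intro image_eqI[of _ _ 0]) auto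
  \<comment> \<open>\<open>l + (n - 1)\<close> stands for the slice just before the arc; it is
    outside the arc because \<open>Suc r < n\<close>.\<close>
  moreover have "(l + (n - 1)) mod n \<in> set h"
  proof (rule ccontr)
    assume "(l + (n - 1)) mod n \<notin> set h"
    moreover have "(l + (n - 1)) mod n < n" using n by simp
    ultimately have "(l + (n - 1)) mod n \<in> (\<lambda>k. (l + k) mod n) ` {..<Suc r}"
      using eq by blast
    then obtain k where "(l + (n - 1)) mod n = (l + k) mod n" "k < Suc r" by auto
    then show False using mod_add_inj[of l "n - 1" n k] n by auto
  qed
  moreover have "adjacent n ((l + (n - 1)) mod n) (l mod n)"
    using n by (simp add: adjacent_def mod_simps)
  ultimately show "legal_move n h (l mod n)" by (auto simp: legal_move_def)
  have "{..<n} - set (h @ [l mod n]) = (\<lambda>k. (l + k) mod n) ` {..<Suc r} - {l mod n}"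
    using eq by auto
  also have "\<dots> = (\<lambda>k. (l + k) mod n) ` Suc ` {..<r}"
  proof -
    have "l mod n \<notin> (\<lambda>k. (l + k) mod n) ` Suc ` {..<r}"
    proof
      assume "l mod n \<in> (\<lambda>k. (l + k) mod n) ` Suc ` {..<r}"
      then obtain k where "k < r" "(l + Suc k) mod n = l mod n" by force
      then show False using *[of "Suc k"] n by simp
    qed
    then show ?thesis by (simp add: lessThan_Suc_eq_insert_0 del: image_Suc_lessThan)
  qed
  finally have "{..<n} - set (h @ [l mod n]) = (\<lambda>k. (l + 1 + k) mod n) ` {..<r}"
    by (simp add: image_image del: image_Suc_lessThan)
  then show "untaken n (h @ [l mod n]) (l + 1) r"
    using assms n by (auto simp: untaken_def)
qed

lemma untaken_take_right:
  assumes "untaken n h l (Suc r)" "h \<noteq> []"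
  shows "legal_move n h ((l + r) mod n)" "untaken n (h @ [(l + r) mod n]) l r"
proof -
  have n: "Suc r < n" using assms by (cases h) (auto simp: untaken_def)
  have sub: "set h \<subseteq> {..<n}" and eq: "{..<n} - set h = (\<lambda>k. (l + k) mod n) ` {..<Suc r}"
    using assms by (auto simp: untaken_def)
  have "(l + r) mod n \<in> {..<n} - set h" unfolding eq by (intro image_eqI[of _ _ r]) auto
  moreover have "(l + Suc r) mod n \<in> set h"
  proof (rule ccontr)
    assume "(l + Suc r) mod n \<notin> set h"
    moreover have "(l + Suc r) mod n < n" using n by simp
    ultimately have "(l + Suc r) mod n \<in> (\<lambda>k. (l + k) mod n) ` {..<Suc r}"
      using eq by blast
    then obtain k where "(l + Suc r) mod n = (l + k) mod n" "k < Suc r" by auto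
    then show False using mod_add_inj[of l "Suc r" n k] n by auto
  qed
  moreover have "adjacent n ((l + Suc r) mod n) ((l + r) mod n)"
    by (simp add: adjacent_def mod_simps)
  ultimately show "legal_move n h ((l + r) mod n)" by (auto simp: legal_move_def)
  have "{..<n} - set (h @ [(l + r) mod n]) = (\<lambda>k. (l + k) mod n) ` {..<Suc r} - {(l + r) mod n}"
    using eq by auto
  also have "\<dots> = (\<lambda>k. (l + k) mod n) ` {..<r}"
  proof -
    have "(l + k) mod n \<noteq> (l + r) mod n" if "k < r" for k
      using mod_add_inj[of l k n r] n that by auto
    then show ?thesis by (auto simp: lessThan_Suc)
  qed
  finally show "untaken n (h @ [(l + r) mod n]) l r"
    using assms n by (auto simp: untaken_def)
qed

section \<open>Values of positions\<close>

text \<open>In a position in which Bob is to move, the untaken slices are \<open>l, \<dots>, l + r - 1\<close> modulo \<open>n\<close>,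
  and \<open>p i\<close> stands for the size of slice \<open>i mod n\<close>. In \<open>secures p j l r x\<close>
  Alice collects at least \<open>x\<close> from them with at most \<open>j\<close> jumps; in
  \<open>concedes p l r x\<close> Bob lets her collect at most \<open>x\<close>.\<close>

fun secures :: "(nat \<Rightarrow> real) \<Rightarrow> nat \<Rightarrow> nat \<Rightarrow> nat \<Rightarrow> real \<Rightarrow> bool" where
  "secures p j l 0 x \<longleftrightarrow> x \<le> 0"
| "secures p j l (Suc 0) x \<longleftrightarrow> x \<le> 0"
| "secures p j l (Suc (Suc r)) x \<longleftrightarrow>
    (secures p j (l + 2) r (x - p (l + 1)) \<or>
      0 < j \<and> secures p (j - 1) (l + 1) r (x - p (l + Suc r))) \<and>
    (secures p j l r (x - p (l + r)) \<or>
      0 < j \<and> secures p (j - 1) (l + 1) r (x - p l))"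

fun concedes :: "(nat \<Rightarrow> real) \<Rightarrow> nat \<Rightarrow> nat \<Rightarrow> real \<Rightarrow> bool" where
  "concedes p l 0 x \<longleftrightarrow> 0 \<le> x"
| "concedes p l (Suc 0) x \<longleftrightarrow> 0 \<le> x"
| "concedes p l (Suc (Suc r)) x \<longleftrightarrow>
    concedes p (l + 2) r (x - p (l + 1)) \<and> concedes p (l + 1) r (x - p (l + Suc r)) \<or>
    concedes p l r (x - p (l + r)) \<and> concedes p (l + 1) r (x - p l)"

section \<open>From values of positions to strategies and plays\<close>

lemma alice_total_single: "alice_total P [z] = P z"
  using alice_total_append[of P "[]" z] by (simp add: alice_total_def[of P "[]"])

lemma alice_total_append2:
  "odd (length h) \<Longrightarrow> alice_total P (h @ [b, i]) = alice_total P h + P i"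
  using alice_total_append[of P "h @ [b]" i] alice_total_append[of P h b] by simp

lemma alice_jumps_append2:
  "odd (length h) \<Longrightarrow> alice_jumps n (h @ [b, i]) = alice_jumps n h + (if adjacent n b i then 0 else 1)"
  using alice_jumps_append[of n "h @ [b]" i] alice_jumps_append[of n h b] by simp

text \<open>The invariant couples two budgets: jumps made plus jumps left stay within
  \<open>J\<close>, and the amount missing to \<open>G\<close> can still be secured from the
  arc.\<close>

lemma secures_strategy:
  fixes P :: "nat \<Rightarrow> real"
  assumes z: "z < n" and sec: "secures (\<lambda>k. P (k mod n)) J (z + 1) (n - 1) (G - P z)"
  shows "\<exists>s. jump_strategy n J s \<and> has_gain n P s G"
proof -
  define p where "p = (\<lambda>k. P (k mod n))"
  define Q where "Q h \<longleftrightarrow> h \<noteq> [] \<and> (\<exists>l r j. untaken n h l r \<and> alice_jumps n h + j \<le> J \<and>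
    secures p j l r (G - alice_total P h))" for h
  have "Q [z]"
    unfolding Q_def
  proof (intro conjI exI)
    show "untaken n [z] (z + 1) (n - 1)" using z by (rule untaken_start)
    show "alice_jumps n [z] + J \<le> J" using alice_jumps_append[of n "[]" z]
      by (simp add: alice_jumps_def is_jump_def)
    show "secures p J (z + 1) (n - 1) (G - alice_total P [z])"
      using sec by (simp add: p_def alice_total_single)
  qed simp
  moreover have "legal_move n [] z" using z by (simp add: legal_move_def)
  moreover have "\<exists>i. legal_move n (h @ [b]) i \<and> Q (h @ [b, i])"
    if h: "legal_play n h" "odd (length h)" "Q h" "legal_move n h b" "Suc (length h) < n" for h b
  proof -
    obtain l r j where u: "untaken n h l r" and j: "alice_jumps n h + j \<le> J"
      and s: "secures p j l r (G - alice_total P h)" and ne: "h \<noteq> []"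
      using h(3) by (auto simp: Q_def)
    have "2 \<le> r" using u h(5) by (auto simp: untaken_def)
    then obtain r' where r: "r = Suc (Suc r')" by (metis add_2_eq_Suc le_Suc_ex)
    have shift: "\<exists>i. legal_move n (h @ [b]) i \<and> Q (h @ [b, i])"
      if "legal_move n (h @ [b]) (i mod n)" "untaken n ((h @ [b]) @ [i mod n]) l' r'"
        "secures p j l' r' (G - alice_total P h - p i)" "adjacent n b (i mod n)" for i l'
      using that j h(2) unfolding Q_def
      by (auto simp: alice_total_append2 alice_jumps_append2 p_def diff_diff_eq)
    have jump: "\<exists>i. legal_move n (h @ [b]) i \<and> Q (h @ [b, i])"
      if "legal_move n (h @ [b]) (i mod n)" "untaken n ((h @ [b]) @ [i mod n]) l' r'" "0 < j"
        "secures p (j - 1) l' r' (G - alice_total P h - p i)" for i l'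
    proof -
      from that(3) obtain j' where j': "j = Suc j'" using not0_implies_Suc by auto
      then have "alice_jumps n (h @ [b, i mod n]) + j' \<le> J"
        using j alice_jumps_append2[OF h(2), of n b "i mod n"] by (auto split: if_splits)
      moreover have "secures p j' l' r' (G - alice_total P (h @ [b, i mod n]))"
        using that(4) h(2) by (simp add: j' alice_total_append2 p_def diff_diff_eq)
      ultimately show ?thesis using that(1,2) unfolding Q_def
        by (intro exI[of _ "i mod n"]) auto
    qed
    from untaken_legal_cases[OF u[unfolded r] ne h(4)]
    consider "b = l mod n" | "b = (l + Suc r') mod n" by blast
    then show ?thesis
    proof cases
      case 1
      have u1: "untaken n (h @ [b]) (l + 1) (Suc r')"
        using untaken_take_left[OF u[unfolded r] ne] 1 by simp
      have "adjacent n b ((l + 1) mod n)" by (simp add: 1 adjacent_def mod_simps)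
      then show ?thesis
        using s[unfolded r] untaken_take_left[OF u1] untaken_take_right[OF u1]
          shift[of "l + 1" "l + 2"] jump[of "l + Suc r'" "l + 1"] by auto
    next
      case 2
      have u1: "untaken n (h @ [b]) l (Suc r')"
        using untaken_take_right[OF u[unfolded r] ne] 2 by simp
      have "adjacent n b ((l + r') mod n)" by (simp add: 2 adjacent_def mod_simps)
      then show ?thesis
        using s[unfolded r] untaken_take_left[OF u1] untaken_take_right[OF u1]
          shift[of "l + r'" l] jump[of l "l + 1"] by auto
    qed
  qed
  ultimately obtain s where s: "alice_strategy n s"
      "\<And>h t. h \<in> outcomes n s \<Longrightarrow> t \<le> n \<Longrightarrow> odd t \<Longrightarrow> Q (take t h)"
    using strategy_from_invariant[of n z Q] by metis
  have "G \<le> alice_total P h \<and> alice_jumps n h \<le> J" if h: "h \<in> outcomes n s" for h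
  proof -
    have lh: "length h = n" using h by (simp add: outcomes_def)
    define g where "g = (if odd n then h else butlast h)"
    have "g = take (if odd n then n else n - 1) h" using lh by (simp add: g_def butlast_conv_take)
    moreover have "odd (if odd n then n else n - 1)" using z by auto
    ultimately have Qg: "Q g" using s(2)[OF h, of "if odd n then n else n - 1"] by (simp split: if_splits)
    have "alice_total P h = alice_total P g \<and> alice_jumps n h = alice_jumps n g"
      using last_move_of_Bob[of h] lh by (simp add: g_def)
    moreover obtain l r j where u: "untaken n g l r" and j: "alice_jumps n g + j \<le> J"
      and s: "secures p j l r (G - alice_total P g)" using Qg by (auto simp: Q_def)
    \<comment> \<open>With at most one slice left Alice has no further turn, and
      \<open>secures\<close> then says that nothing is missing.\<close>
    moreover have "r = 0 \<or> r = Suc 0" using u lh z by (auto simp: untaken_def g_def split: if_splits)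
    ultimately show ?thesis by auto
  qed
  then show ?thesis using s(1) by (auto simp: jump_strategy_def has_gain_def)
qed

text \<open>The dual of \<open>secures_strategy\<close>: Bob keeps Alice's future income within what
  remains of \<open>G\<close>. Her jumps are not counted, so the bound holds against all her
  strategies.\<close>

lemma concedes_play:
  fixes P :: "nat \<Rightarrow> real"
  assumes n: "n \<ge> 1" and s: "alice_strategy n s"
    and con: "\<And>z. z < n \<Longrightarrow> concedes (\<lambda>k. P (k mod n)) (z + 1) (n - 1) (G - P z)"
  shows "\<exists>h\<in>outcomes n s. alice_total P h \<le> G"
proof -
  define p where "p = (\<lambda>k. P (k mod n))"
  define Q where "Q h \<longleftrightarrow> h \<noteq> [] \<and> (\<exists>l r. untaken n h l r \<and>
    concedes p l r (G - alice_total P h))" for h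
  have start: "Q [z]" if "legal_move n [] z" for z
    unfolding Q_def
  proof (intro conjI exI)
    have z: "z < n" using that by (simp add: legal_move_def)
    then show "untaken n [z] (z + 1) (n - 1)" by (rule untaken_start)
    show "concedes p (z + 1) (n - 1) (G - alice_total P [z])"
      using con[OF z] by (simp add: p_def alice_total_single)
  qed simp
  have step: "\<exists>b. legal_move n h b \<and> (\<forall>i. legal_move n (h @ [b]) i \<longrightarrow> Q (h @ [b, i]))"
    if h: "legal_play n h" "odd (length h)" "Q h" "length h < n" for h
  proof -
    obtain l r where u: "untaken n h l r"
      and s: "concedes p l r (G - alice_total P h)" and ne: "h \<noteq> []"
      using h(3) by (auto simp: Q_def)
    have "r \<noteq> 0" using u h(4) by (auto simp: untaken_def)
    then obtain r' where r: "r = Suc r'" using not0_implies_Suc by blast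
    show ?thesis
    proof (cases r')
      case 0
      \<comment> \<open>Bob takes the only slice left; Alice has no legal reply, so nothing has to
        be restored.\<close>
      have "untaken n (h @ [l mod n]) (l + 1) 0" using untaken_take_left(2)[OF u[unfolded r 0] ne] .
      then have "\<not> legal_move n (h @ [l mod n]) i" for i
        unfolding untaken_def legal_move_def by auto
      then show ?thesis using untaken_take_left(1)[OF u[unfolded r 0] ne] by blast
    next
      case (Suc r'')
      note u' = u[unfolded r Suc] and s' = s[unfolded r Suc]
      have reply: "Q (h @ [b, i])" if "untaken n ((h @ [b]) @ [i]) l' r''" "i = k mod n"
        "concedes p l' r'' (G - alice_total P h - p k)" for b i l' k
        using that h(2) unfolding Q_def by (auto simp: alice_total_append2 p_def diff_diff_eq)
      from s' consider
          "concedes p (l + 2) r'' (G - alice_total P h - p (l + 1))"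
          "concedes p (l + 1) r'' (G - alice_total P h - p (l + Suc r''))"
        | "concedes p l r'' (G - alice_total P h - p (l + r''))"
          "concedes p (l + 1) r'' (G - alice_total P h - p l)" by auto
      then show ?thesis
      proof cases
        case 1
        let ?b = "l mod n"
        have u1: "untaken n (h @ [?b]) (l + 1) (Suc r'')"
          using untaken_take_left[OF u' ne] by simp
        have "Q (h @ [?b, i])" if "legal_move n (h @ [?b]) i" for i
          using untaken_legal_cases[OF u1 _ that] untaken_take_left[OF u1] untaken_take_right[OF u1]
            reply[of ?b i "l + 2" "l + 1"] reply[of ?b i "l + 1" "l + Suc r''"] 1 by auto
        then show ?thesis using untaken_take_left[OF u' ne] by blast
      next
        case 2
        let ?b = "(l + Suc r'') mod n"
        have u1: "untaken n (h @ [?b]) l (Suc r'')"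
          using untaken_take_right[OF u' ne] by simp
        have "Q (h @ [?b, i])" if "legal_move n (h @ [?b]) i" for i
          using untaken_legal_cases[OF u1 _ that] untaken_take_left[OF u1] untaken_take_right[OF u1]
            reply[of ?b i "l + 1" l] reply[of ?b i l "l + r''"] 2 by auto
        then show ?thesis using untaken_take_right[OF u' ne] by blast
      qed
    qed
  qed
  obtain h where h: "h \<in> outcomes n s" and Qg: "Q (if odd n then h else butlast h)"
    using play_from_invariant[of n s Q, OF s n start step] by blast
  define g where "g = (if odd n then h else butlast h)"
  have lh: "length h = n" using h by (simp add: outcomes_def)
  have "alice_total P h = alice_total P g"
    using last_move_of_Bob[of h] lh by (simp add: g_def)
  moreover obtain l r where u: "untaken n g l r" and s: "concedes p l r (G - alice_total P g)"
    using Qg by (auto simp: Q_def g_def)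
  moreover have "r = 0 \<or> r = Suc 0" using u lh n by (auto simp: untaken_def g_def split: if_splits)
  ultimately show ?thesis using h by (intro bexI[of _ h]) auto
qed

section \<open>Following Bob\<close>

definition alt_sum :: "(nat \<Rightarrow> real) \<Rightarrow> nat \<Rightarrow> nat \<Rightarrow> real" where
  "alt_sum p a k = (\<Sum>i<k. p (a + 2 * i))"

lemma alt_sum_0 [simp]: "alt_sum p a 0 = 0"
  by (simp add: alt_sum_def)

lemma alt_sum_Suc: "alt_sum p a (Suc k) = alt_sum p a k + p (a + 2 * k)"
  by (simp add: alt_sum_def)

text \<open>\<open>b\<close> is a separate variable so that differently written start points can be
  matched by arithmetic.\<close>

lemma alt_sum_split: "k = i + j \<Longrightarrow> b = a + 2 * i \<Longrightarrow> alt_sum p a k = alt_sum p a i + alt_sum p b j"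
proof (induction j arbitrary: k)
  case (Suc j)
  then show ?case using Suc.IH[of "i + j"] by (simp add: alt_sum_Suc algebra_simps)
qed simp

lemma alt_sum_head: "alt_sum p a (Suc k) = p a + alt_sum p (a + 2) k"
  using alt_sum_split[of "Suc k" 1 k "a + 2" a p] by (simp add: alt_sum_Suc)

lemma alt_sum_periodic:
  assumes "\<And>k. p (k + n) = p k"
  shows "alt_sum p (a + n) k = alt_sum p a k"
  unfolding alt_sum_def
proof (intro sum.cong refl)
  fix i show "p (a + n + 2 * i) = p (a + 2 * i)"
    using assms[of "a + 2 * i"] by (simp add: ac_simps)
qed

lemma alt_sum_nonneg: "(\<And>k. 0 \<le> p k) \<Longrightarrow> 0 \<le> alt_sum p a k"
  unfolding alt_sum_def by (intro sum_nonneg) auto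

text \<open>Always shifting, Alice gets the inner slice of each pair eaten from either end. The
  result depends only on the number \<open>i\<close> of pairs eaten from the left, not on their
  order.\<close>

lemma secures_follow:
  assumes "\<And>i. i \<le> m \<Longrightarrow> x \<le> alt_sum p (l + 1) i + alt_sum p (l + 2 * i) (m - i)"
  shows "secures p j l (2 * m) x"
  using assms
proof (induction m arbitrary: l x)
  case 0
  then show ?case by simp
next
  case (Suc m)
  have "secures p j (l + 2) (2 * m) (x - p (l + 1))"
  proof (rule Suc.IH)
    fix i assume "i \<le> m"
    then show "x - p (l + 1) \<le> alt_sum p (l + 2 + 1) i + alt_sum p (l + 2 + 2 * i) (m - i)"
      using Suc.prems[of "Suc i"] alt_sum_head[of p "l + 1" i] by (simp add: algebra_simps)
  qed
  moreover have "secures p j l (2 * m) (x - p (l + 2 * m))"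
  proof (rule Suc.IH)
    fix i assume i: "i \<le> m"
    then have "alt_sum p (l + 2 * i) (Suc m - i) = alt_sum p (l + 2 * i) (m - i) + p (l + 2 * i + 2 * (m - i))"
      by (simp add: Suc_diff_le alt_sum_Suc)
    also have "l + 2 * i + 2 * (m - i) = l + 2 * m" using i by simp
    finally have "alt_sum p (l + 2 * i) (Suc m - i) = alt_sum p (l + 2 * i) (m - i) + p (l + 2 * m)" .
    then show "x - p (l + 2 * m) \<le> alt_sum p (l + 1) i + alt_sum p (l + 2 * i) (m - i)"
      using Suc.prems[of i] i by simp
  qed
  ultimately show ?case by simp
qed

text \<open>On an arc of odd length, shifts at both ends yield the same colour, so Bob has no
  influence.\<close>

lemma secures_follow_odd: "secures p j l (Suc (2 * m)) (alt_sum p (l + 1) m)"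
proof (induction m arbitrary: l)
  case (Suc m)
  have "secures p j (l + 2) (Suc (2 * m)) (alt_sum p (l + 1) (Suc m) - p (l + 1))"
    using Suc[of "l + 2"] alt_sum_head[of p "l + 1" m] by simp
  moreover have "secures p j l (Suc (2 * m)) (alt_sum p (l + 1) (Suc m) - p (l + Suc (2 * m)))"
    using Suc[of l] by (simp add: alt_sum_Suc)
  ultimately show ?case by simp
qed simp

text \<open>The ends of an even arc have different colours. Bob takes the end of the colour he
  wants; then both ends have the other one, so Alice is confined to a colour of his choice, whether
  she shifts or jumps.\<close>

lemma concedes_colour:
  "(alt_sum p l m \<le> x \<longrightarrow> concedes p l (2 * m) x) \<and> (alt_sum p (l + 1) m \<le> x \<longrightarrow> concedes p l (2 * m) x)"
proof (induction m arbitrary: l x)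
  case (Suc m)
  have "concedes p l (2 * m) (x - p (l + 2 * m)) \<and> concedes p (l + 1) (2 * m) (x - p l)"
    if "alt_sum p l (Suc m) \<le> x"
    using Suc[of l "x - p (l + 2 * m)"] Suc[of "l + 1" "x - p l"] that
      alt_sum_Suc[of p l m] alt_sum_head[of p l m] by simp
  moreover have "concedes p (l + 2) (2 * m) (x - p (l + 1)) \<and>
      concedes p (l + 1) (2 * m) (x - p (l + Suc (2 * m)))"
    if "alt_sum p (l + 1) (Suc m) \<le> x"
    using Suc[of "l + 2" "x - p (l + 1)"] Suc[of "l + 1" "x - p (l + Suc (2 * m))"] that
      alt_sum_Suc[of p "l + 1" m] alt_sum_head[of p "l + 1" m] by simp
  ultimately show ?case by auto
qed simp

section \<open>Three odd blocks\<close>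

declare secures.simps [simp del]

text \<open>The block is \<open>u, \<dots>, u + 2 * L\<close>. Its slices are called odd or even by
  their position counted from 1, so \<open>u, u + 2, \<dots>\<close> are the odd ones and both ends
  are odd.\<close>

definition dominated :: "(nat \<Rightarrow> real) \<Rightarrow> nat \<Rightarrow> nat \<Rightarrow> bool" where
  "dominated p u L \<longleftrightarrow> (\<forall>i\<le>L. alt_sum p u i \<le> alt_sum p (u + 1) i)
     \<and> (\<forall>i\<le>L. alt_sum p (u + 2 * i + 2) (L - i) \<le> alt_sum p (u + 2 * i + 1) (L - i))"

lemma dominated_prefix: "dominated p u L \<Longrightarrow> i \<le> L \<Longrightarrow> alt_sum p u i \<le> alt_sum p (u + 1) i"
  by (simp add: dominated_def)

lemma dominated_suffix:
  assumes "dominated p u L" "i + k = L" "v = u + 2 * i + 1"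
  shows "alt_sum p (v + 1) k \<le> alt_sum p v k"
proof -
  have "alt_sum p (u + 2 * i + 2) (L - i) \<le> alt_sum p (u + 2 * i + 1) (L - i)"
    using assms(1,2) unfolding dominated_def by simp
  then show ?thesis using assms(2,3) by auto
qed

locale blocks =
  fixes p :: "nat \<Rightarrow> real" and n g L1 L2 L3 :: nat
  assumes periodic: "p (k + n) = p k"
    and n_eq: "n = 2 * L1 + 2 * L2 + 2 * L3 + 3"
    and dom1: "dominated p g L1"
    and dom2: "dominated p (g + 2 * L1 + 1) L2"
    and dom3: "dominated p (g + 2 * L1 + 2 * L2 + 2) L3"
begin

abbreviation "g2 \<equiv> g + 2 * L1 + 1"
abbreviation "g3 \<equiv> g + 2 * L1 + 2 * L2 + 2"
abbreviation "odds1 k \<equiv> alt_sum p g k"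
abbreviation "evens1 k \<equiv> alt_sum p (g + 1) k"

text \<open>The arguments of \<open>min\<close> are Alice's shares of the second and third block
  when she shifts and Bob eats both from one end only; by domination no mixture is worse for
  her.\<close>

definition rest :: real where
  "rest = min (alt_sum p g2 (Suc L2) + alt_sum p (g3 + 1) L3) (alt_sum p (g2 + 1) L2 + alt_sum p g3 (Suc L3))"

lemma rest_le:
  "rest \<le> alt_sum p g2 (Suc L2) + alt_sum p (g3 + 1) L3"
  "rest \<le> alt_sum p (g2 + 1) L2 + alt_sum p g3 (Suc L3)"
  by (simp_all add: rest_def)

text \<open>Pure shifting once the first block is gone up to \<open>g + 2 * t\<close>. The point
  where the two eaten sides finally meet may lie in any block; the domination of that block compares
  it with an extreme case.\<close>

lemma follow_left:
  assumes t: "t \<le> L1" and x: "x \<le> odds1 (Suc L1) - odds1 (Suc t) + rest"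
  shows "secures p j (g + 2 * t + 1) (2 * (L1 - t + L2 + L3 + 1)) x"
proof (rule secures_follow)
  define m where "m = L1 - t + L2 + L3 + 1"
  fix i assume i: "i \<le> L1 - t + L2 + L3 + 1"
  have E: "alt_sum p (g + 2 * t + 2) (L1 - t) = odds1 (Suc L1) - odds1 (Suc t)"
    using alt_sum_split[of "Suc L1" "Suc t" "L1 - t" "g + 2 * t + 2" g p] t by simp
  let ?r = "alt_sum p (g + 2 * t + 1 + 1) i + alt_sum p (g + 2 * t + 1 + 2 * i) (m - i)"
  have "odds1 (Suc L1) - odds1 (Suc t) + rest \<le> ?r"
  proof -
    consider (1) k where "i + k = L1 - t" | (2) i' k where "i = L1 - t + i'" "i' + k = L2"
      | (3) i' k where "i = L1 - t + L2 + 1 + i'" "i' + k = L3"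
    proof (cases "i \<le> L1 - t")
      case True then show ?thesis using 1[of "L1 - t - i"] by simp
    next
      case False
      show ?thesis
      proof (cases "i \<le> L1 - t + L2")
        case True then show ?thesis
          using False 2[of "i - (L1 - t)" "L2 - (i - (L1 - t))"] by simp
      next
        case False then show ?thesis
          using i 3[of "i - (L1 - t + L2 + 1)" "L3 - (i - (L1 - t + L2 + 1))"] by simp
      qed
    qed
    then show ?thesis
    proof cases
      case 1
      have a: "alt_sum p (g + 2 * t + 2) (L1 - t) = alt_sum p (g + 2 * t + 2) i + alt_sum p (g + 2 * t + 2 * i + 2) k"
        by (rule alt_sum_split) (use 1 in simp_all)
      have b: "alt_sum p (g + 2 * t + 1 + 2 * i) (m - i) =
          alt_sum p (g + 2 * t + 2 * i + 1) k + alt_sum p g2 (Suc L2 + L3)"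
        by (subst alt_sum_split[where i = k and j = "Suc L2 + L3" and b = g2]) (use 1 t in \<open>auto simp: m_def ac_simps\<close>)
      have c: "alt_sum p g2 (Suc L2 + L3) = alt_sum p g2 (Suc L2) + alt_sum p (g3 + 1) L3"
        by (rule alt_sum_split) auto
      have "alt_sum p (g + 2 * t + 2 * i + 2) k \<le> alt_sum p (g + 2 * t + 2 * i + 1) k"
        using dominated_suffix[OF dom1, of "t + i" k "g + 2 * t + 2 * i + 1"] 1 t by (simp add: ac_simps)
      then show ?thesis using a b c E rest_le(1) by (simp add: ac_simps)
    next
      case 2
      have a: "alt_sum p (g + 2 * t + 2) i = alt_sum p (g + 2 * t + 2) (L1 - t) + alt_sum p (g2 + 1) i'"
        by (rule alt_sum_split) (use 2 t in simp_all)
      have b: "alt_sum p (g + 2 * t + 1 + 2 * i) (m - i) =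
          alt_sum p (g2 + 2 * i') (Suc k) + alt_sum p (g3 + 1) L3"
        by (subst alt_sum_split[where i = "Suc k" and j = L3 and b = "g3 + 1"])
          (use 2 t in \<open>auto simp: m_def algebra_simps\<close>)
      have c: "alt_sum p g2 (Suc L2) = alt_sum p g2 i' + alt_sum p (g2 + 2 * i') (Suc k)"
        by (rule alt_sum_split) (use 2 in auto)
      have "alt_sum p g2 i' \<le> alt_sum p (g2 + 1) i'"
        using dominated_prefix[OF dom2, of i'] 2 by simp
      then show ?thesis using a b c E rest_le(1) by (simp add: ac_simps)
    next
      case 3
      have a: "alt_sum p (g + 2 * t + 2) i = alt_sum p (g + 2 * t + 2) (L1 - t) + alt_sum p (g2 + 1) (L2 + Suc i')"
        by (rule alt_sum_split) (use 3 t in simp_all)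
      have a': "alt_sum p (g2 + 1) (L2 + Suc i') = alt_sum p (g2 + 1) L2 + alt_sum p g3 (Suc i')"
        by (rule alt_sum_split) auto
      have b: "alt_sum p (g + 2 * t + 1 + 2 * i) (m - i) = alt_sum p (g3 + 2 * i' + 1) k"
        using 3 t by (auto simp: m_def algebra_simps intro!: arg_cong2[of _ _ _ _ "alt_sum p"])
      have c: "alt_sum p g3 (Suc L3) = alt_sum p g3 (Suc i') + alt_sum p (g3 + 2 * i' + 1 + 1) k"
        by (rule alt_sum_split) (use 3 in auto)
      have "alt_sum p (g3 + 2 * i' + 1 + 1) k \<le> alt_sum p (g3 + 2 * i' + 1) k"
        using dominated_suffix[OF dom3, of i' k "g3 + 2 * i' + 1"] 3 by simp
      then show ?thesis using a a' b c E rest_le(2) by (simp add: ac_simps)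
    qed
  qed
  then show "x \<le> alt_sum p (g + 2 * t + 1 + 1) i + alt_sum p (g + 2 * t + 1 + 2 * i) (L1 - t + L2 + L3 + 1 - i)"
    using x unfolding m_def by linarith
qed

text \<open>The mirror situation: of the first block only \<open>g, \<dots>, g + 2 * s - 1\<close>
  are left. They close the arc after a full turn and so appear shifted by \<open>n\<close>.\<close>

lemma follow_right:
  assumes s: "s \<le> L1" and x: "x \<le> odds1 s + rest"
  shows "secures p j g2 (2 * (L2 + L3 + 1 + s)) x"
proof (rule secures_follow)
  define m where "m = L2 + L3 + 1 + s"
  have per: "alt_sum p (g + n) k = odds1 k" "alt_sum p (g + n + 1) k = evens1 k" for k
    using alt_sum_periodic[of p n g, OF periodic] alt_sum_periodic[of p n "g + 1", OF periodic] by (simp_all add: ac_simps)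
  fix i assume i: "i \<le> L2 + L3 + 1 + s"
  let ?r = "alt_sum p (g2 + 1) i + alt_sum p (g2 + 2 * i) (m - i)"
  have "odds1 s + rest \<le> ?r"
  proof -
    consider (1) k where "i + k = L2" | (2) i' k where "i = L2 + 1 + i'" "i' + k = L3"
      | (3) i' k where "i = L2 + L3 + 1 + i'" "i' + k = s"
    proof (cases "i \<le> L2")
      case True then show ?thesis using 1[of "L2 - i"] by simp
    next
      case False
      show ?thesis
      proof (cases "i \<le> L2 + L3 + 1")
        case True then show ?thesis
          using False 2[of "i - (L2 + 1)" "L3 - (i - (L2 + 1))"] by simp
      next
        case False then show ?thesis
          using i 3[of "i - (L2 + L3 + 1)" "s - (i - (L2 + L3 + 1))"] by simp
      qed
    qed
    then show ?thesis
    proof cases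
      case 1
      have a: "alt_sum p (g2 + 2 * i) (m - i) = alt_sum p (g2 + 2 * i) (Suc k) + alt_sum p (g3 + 1) (L3 + s)"
        by (rule alt_sum_split) (use 1 in \<open>auto simp: m_def\<close>)
      have b: "alt_sum p (g3 + 1) (L3 + s) = alt_sum p (g3 + 1) L3 + alt_sum p (g + n) s"
        by (rule alt_sum_split) (auto simp: n_eq)
      have c: "alt_sum p g2 (Suc L2) = alt_sum p g2 i + alt_sum p (g2 + 2 * i) (Suc k)"
        by (rule alt_sum_split) (use 1 in auto)
      have "alt_sum p g2 i \<le> alt_sum p (g2 + 1) i"
        using dominated_prefix[OF dom2, of i] 1 by simp
      then show ?thesis using a b c per rest_le(1) by (simp add: ac_simps)
    next
      case 2
      have a: "alt_sum p (g2 + 1) i = alt_sum p (g2 + 1) L2 + alt_sum p g3 (Suc i')"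
        by (rule alt_sum_split) (use 2 in auto)
      have b: "alt_sum p (g2 + 2 * i) (m - i) = alt_sum p (g3 + 2 * i' + 1) k + alt_sum p (g + n) s"
        by (subst alt_sum_split[where i = k and j = s and b = "g + n"])
          (use 2 in \<open>auto simp: m_def n_eq algebra_simps\<close>)
      have c: "alt_sum p g3 (Suc L3) = alt_sum p g3 (Suc i') + alt_sum p (g3 + 2 * i' + 1 + 1) k"
        by (rule alt_sum_split) (use 2 in auto)
      have "alt_sum p (g3 + 2 * i' + 1 + 1) k \<le> alt_sum p (g3 + 2 * i' + 1) k"
        using dominated_suffix[OF dom3, of i' k "g3 + 2 * i' + 1"] 2 by simp
      then show ?thesis using a b c per rest_le(2) by (simp add: ac_simps)
    next
      case 3
      have a: "alt_sum p (g2 + 1) i = alt_sum p (g2 + 1) L2 + alt_sum p g3 (Suc L3 + i')"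
        by (rule alt_sum_split) (use 3 in auto)
      have a': "alt_sum p g3 (Suc L3 + i') = alt_sum p g3 (Suc L3) + alt_sum p (g + n + 1) i'"
        by (rule alt_sum_split) (auto simp: n_eq)
      have b: "alt_sum p (g2 + 2 * i) (m - i) = alt_sum p (g + 2 * i' + n) k"
        using 3 by (auto simp: m_def n_eq algebra_simps intro!: arg_cong2[of _ _ _ _ "alt_sum p"])
      have b': "alt_sum p (g + 2 * i' + n) k = alt_sum p (g + 2 * i') k" by (rule alt_sum_periodic) (rule periodic)
      have c: "odds1 s = odds1 i' + alt_sum p (g + 2 * i') k"
        by (rule alt_sum_split) (use 3 in auto)
      have "odds1 i' \<le> evens1 i'"
        using dominated_prefix[OF dom1, of i'] 3 s by simp
      then show ?thesis using a a' b b' c per rest_le(2) by simp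
    qed
  qed
  then show "x \<le> alt_sum p (g2 + 1) i + alt_sum p (g2 + 2 * i) (L2 + L3 + 1 + s - i)"
    using x unfolding m_def by linarith
qed

text \<open>In the intended position the eaten part of the first block is
  \<open>g + 2 * s + 1, \<dots>, g + 2 * t - 1\<close>, with even slices at both ends. Alice shifts
  on even slices until Bob takes an end of the block, then jumps across and shifts on. The last two
  premises bound \<open>x\<close> by her income if he takes \<open>g\<close>, respectively
  \<open>g + 2 * L1\<close>.\<close>

lemma secures_one_jump:
  assumes "t \<le> L1" "s \<le> L1"
    and "\<And>t'. t \<le> t' \<Longrightarrow> t' \<le> L1 \<Longrightarrow>
      x \<le> evens1 t' - evens1 t + (odds1 (Suc L1) - odds1 t') + evens1 s + rest"
    and "\<And>s'. s' \<le> s \<Longrightarrow>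
      x \<le> evens1 s - evens1 s' + odds1 (Suc s') + (evens1 L1 - evens1 t) + rest"
  shows "secures p (Suc j) (g + 2 * t) (2 * (L1 - t + L2 + L3 + 2 + s)) x"
  using assms
proof (induction "L1 - t + s" arbitrary: t s x rule: less_induct)
  case less
  define r where "r = 2 * (L1 - t + L2 + L3 + 1 + s)"
  have pB: "p (g + 2 * k + 1) = evens1 (Suc k) - evens1 k" for k
    by (simp add: alt_sum_Suc ac_simps)
  have pE: "p (g + 2 * k) = odds1 (Suc k) - odds1 k" for k
    by (simp add: alt_sum_Suc)
  have right_end: "g + 2 * t + Suc r = g + 2 * s + n" "s \<noteq> 0 \<Longrightarrow> g + 2 * t + r = (g + 2 * (s - 1) + 1) + n"
    using less.prems(1) by (auto simp: r_def n_eq)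
  have left: "secures p (Suc j) (g + 2 * t + 2) r (x - p (g + 2 * t + 1)) \<or>
    secures p j (g + 2 * t + 1) r (x - p (g + 2 * t + Suc r))"
  proof (cases "t < L1")
    case True
    have "secures p (Suc j) (g + 2 * Suc t) (2 * (L1 - Suc t + L2 + L3 + 2 + s)) (x - p (g + 2 * t + 1))"
    proof (rule less.hyps)
      fix t' assume "Suc t \<le> t'" "t' \<le> L1"
      then show "x - p (g + 2 * t + 1)
          \<le> evens1 t' - evens1 (Suc t) + (odds1 (Suc L1) - odds1 t') + evens1 s + rest"
        using less.prems(3)[of t'] unfolding pB by simp
    next
      fix s' assume "s' \<le> s"
      then show "x - p (g + 2 * t + 1)
          \<le> evens1 s - evens1 s' + odds1 (Suc s') + (evens1 L1 - evens1 (Suc t)) + rest"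
        using less.prems(4)[of s'] unfolding pB by simp
    qed (use True less.prems in auto)
    moreover have "2 * (L1 - Suc t + L2 + L3 + 2 + s) = r" using True by (auto simp: r_def)
    ultimately show ?thesis by simp
  next
    case False
    \<comment> \<open>Bob takes the last slice \<open>g + 2 * L1\<close> of the block; Alice jumps
      to \<open>g + 2 * s\<close> at the other end of the arc.\<close>
    then have t: "t = L1" using less.prems by simp
    have "secures p j g2 (2 * (L2 + L3 + 1 + s)) (x - p (g + 2 * s))"
    proof (rule follow_right)
      show "x - p (g + 2 * s) \<le> odds1 s + rest"
        using less.prems(4)[of s] unfolding pE t by simp
    qed (use less.prems in simp)
    then show ?thesis unfolding right_end periodic using t by (simp add: r_def ac_simps)
  qed
  have right: "secures p (Suc j) (g + 2 * t) r (x - p (g + 2 * t + r)) \<or>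
    secures p j (g + 2 * t + 1) r (x - p (g + 2 * t))"
  proof (cases "s = 0")
    case False
    define s1 where "s1 = s - 1"
    have s: "s = Suc s1" using False by (simp add: s1_def)
    have "secures p (Suc j) (g + 2 * t) (2 * (L1 - t + L2 + L3 + 2 + s1)) (x - p (g + 2 * s1 + 1))"
    proof (rule less.hyps)
      fix t' assume "t \<le> t'" "t' \<le> L1"
      then show "x - p (g + 2 * s1 + 1)
          \<le> evens1 t' - evens1 t + (odds1 (Suc L1) - odds1 t') + evens1 s1 + rest"
        using less.prems(3)[of t'] unfolding pB s by simp
    next
      fix s' assume "s' \<le> s1"
      then show "x - p (g + 2 * s1 + 1)
          \<le> evens1 s1 - evens1 s' + odds1 (Suc s') + (evens1 L1 - evens1 t) + rest"
        using less.prems(4)[of s'] unfolding pB s by simp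
    qed (use s less.prems in auto)
    moreover have "2 * (L1 - t + L2 + L3 + 2 + s1) = r" using s by (auto simp: r_def)
    moreover have "p (g + 2 * t + r) = p (g + 2 * s1 + 1)"
      unfolding right_end(2)[OF False] periodic s1_def ..
    ultimately show ?thesis by simp
  next
    case True
    \<comment> \<open>Bob takes the first slice \<open>g\<close> of the block; Alice jumps to
      \<open>g + 2 * t\<close>.\<close>
    have "secures p j (g + 2 * t + 1) (2 * (L1 - t + L2 + L3 + 1)) (x - p (g + 2 * t))"
    proof (rule follow_left)
      show "x - p (g + 2 * t) \<le> odds1 (Suc L1) - odds1 (Suc t) + rest"
        using less.prems(3)[of t] less.prems(1) unfolding pE True by simp
    qed (use less.prems in simp)
    then show ?thesis using True by (simp add: r_def)
  qed
  have r: "2 * (L1 - t + L2 + L3 + 2 + s) = Suc (Suc r)" by (simp add: r_def)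
  show ?case unfolding r secures.simps using left right by simp
qed

text \<open>Here Alice already holds the odd slices \<open>s, \<dots>, t\<close> of the first block; she leaves the odd
  slices for the even ones as soon as Bob takes the even slice \<open>T - 1\<close> or \<open>S\<close>.\<close>

lemma secures_two_jumps:
  assumes "S < s" "s \<le> \<mu>" "\<mu> \<le> t" "t < T" "T \<le> L1"
    and R1: "\<And>s t'. S < s \<Longrightarrow> s \<le> \<mu> \<Longrightarrow> T \<le> t' \<Longrightarrow> t' \<le> L1 \<Longrightarrow>
      x \<le> odds1 T - odds1 s + evens1 s + evens1 t' - evens1 T + (odds1 (Suc L1) - odds1 t') + rest"
    and R2: "\<And>s s'. S < s \<Longrightarrow> s \<le> \<mu> \<Longrightarrow> s' < s \<Longrightarrow>
      x \<le> odds1 T - odds1 s + evens1 s - evens1 s' + odds1 (Suc s') + (evens1 L1 - evens1 T) + rest"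
    and L1: "\<And>t t'. \<mu> \<le> t \<Longrightarrow> t < T \<Longrightarrow> t < t' \<Longrightarrow> t' \<le> L1 \<Longrightarrow>
      x \<le> odds1 (Suc t) - odds1 (Suc S) + evens1 t' - evens1 t + evens1 S + (odds1 (Suc L1) - odds1 t') + rest"
    and L2: "\<And>t s'. \<mu> \<le> t \<Longrightarrow> t < T \<Longrightarrow> s' \<le> S \<Longrightarrow>
      x \<le> odds1 (Suc t) - odds1 (Suc S) + evens1 S - evens1 s' + odds1 (Suc s') + (evens1 L1 - evens1 t) + rest"
  shows "secures p (Suc (Suc j)) (g + 2 * t + 1) (2 * (L1 - t + L2 + L3 + 1 + s))
    (x - (odds1 (Suc t) - odds1 s))"
  using assms(1-4)
proof (induction "T - t + s" arbitrary: s t rule: less_induct)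
  case less
  define r where "r = 2 * (L1 - t + L2 + L3 + s)"
  have pB: "p (g + 2 * k + 1) = evens1 (Suc k) - evens1 k" for k
    by (simp add: alt_sum_Suc ac_simps)
  have pE: "p (g + 2 * k) = odds1 (Suc k) - odds1 k" for k
    by (simp add: alt_sum_Suc)
  define s1 where "s1 = s - 1"
  have s: "s = Suc s1" using less.prems by (simp add: s1_def)
  have tL: "t < L1" using less.prems assms(5) by simp
  have right_end: "g + 2 * t + 1 + Suc r = (g + 2 * s1 + 1) + n" "g + 2 * t + 1 + r = (g + 2 * s1) + n"
    using tL by (auto simp: r_def n_eq s)
  let ?x = "x - (odds1 (Suc t) - odds1 s)"
  have left: "secures p (Suc (Suc j)) (g + 2 * t + 3) r (?x - p (g + 2 * t + 2)) \<or>
    secures p (Suc j) (g + 2 * t + 2) r (?x - p (g + 2 * t + 1 + Suc r))"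
  proof (cases "Suc t < T")
    case True
    have "secures p (Suc (Suc j)) (g + 2 * Suc t + 1) (2 * (L1 - Suc t + L2 + L3 + 1 + s))
        (x - (odds1 (Suc (Suc t)) - odds1 s))"
      by (rule less.hyps) (use True less.prems in auto)
    moreover have "2 * (L1 - Suc t + L2 + L3 + 1 + s) = r" using tL by (auto simp: r_def)
    moreover have "x - (odds1 (Suc (Suc t)) - odds1 s) = ?x - p (g + 2 * t + 2)"
      using pE[of "Suc t"] by (simp add: algebra_simps)
    moreover have "g + 2 * Suc t + 1 = g + 2 * t + 3" by simp
    ultimately show ?thesis by metis
  next
    case False
    \<comment> \<open>Bob takes even slice \<open>T - 1\<close> and Alice jumps to even slice
      \<open>s - 1\<close>, where even slice \<open>k\<close> is \<open>g + 2 * k + 1\<close>. Now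
      even slices bound the eaten part, and \<open>secures_one_jump\<close> applies with one jump
      fewer.\<close>
    then have T: "T = Suc t" using less.prems by simp
    have "secures p (Suc j) (g + 2 * T) (2 * (L1 - T + L2 + L3 + 2 + s1)) (?x - p (g + 2 * s1 + 1))"
    proof (rule secures_one_jump)
      fix t' assume "T \<le> t'" "t' \<le> L1"
      then show "?x - p (g + 2 * s1 + 1)
          \<le> evens1 t' - evens1 T + (odds1 (Suc L1) - odds1 t') + evens1 s1 + rest"
        using R1[of s t'] less.prems unfolding pB s T by simp
    next
      fix s' assume "s' \<le> s1"
      then show "?x - p (g + 2 * s1 + 1)
          \<le> evens1 s1 - evens1 s' + odds1 (Suc s') + (evens1 L1 - evens1 T) + rest"
        using R2[of s s'] less.prems unfolding pB s T by simp
    qed (use less.prems assms(5) s in auto)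
    moreover have "2 * (L1 - T + L2 + L3 + 2 + s1) = r" using tL by (auto simp: r_def s T)
    ultimately show ?thesis unfolding right_end periodic T by simp
  qed
  have right: "secures p (Suc (Suc j)) (g + 2 * t + 1) r (?x - p (g + 2 * t + 1 + r)) \<or>
    secures p (Suc j) (g + 2 * t + 2) r (?x - p (g + 2 * t + 1))"
  proof (cases "S < s1")
    case True
    have "secures p (Suc (Suc j)) (g + 2 * t + 1) (2 * (L1 - t + L2 + L3 + 1 + s1))
        (x - (odds1 (Suc t) - odds1 s1))"
      by (rule less.hyps) (use True less.prems s in auto)
    moreover have "2 * (L1 - t + L2 + L3 + 1 + s1) = r" by (auto simp: r_def s)
    moreover have "x - (odds1 (Suc t) - odds1 s1) = ?x - p (g + 2 * s1)"
      unfolding pE s by simp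
    ultimately show ?thesis unfolding right_end periodic by simp
  next
    case False
    \<comment> \<open>Symmetrically, Bob takes even slice \<open>S\<close> and Alice jumps to even
      slice \<open>t\<close>.\<close>
    then have S: "S = s1" using less.prems s by simp
    have "secures p (Suc j) (g + 2 * Suc t) (2 * (L1 - Suc t + L2 + L3 + 2 + s1)) (?x - p (g + 2 * t + 1))"
    proof (rule secures_one_jump)
      fix t' assume "Suc t \<le> t'" "t' \<le> L1"
      then show "?x - p (g + 2 * t + 1)
          \<le> evens1 t' - evens1 (Suc t) + (odds1 (Suc L1) - odds1 t') + evens1 s1 + rest"
        using L1[of t t'] less.prems unfolding pB s S by simp
    next
      fix s' assume "s' \<le> s1"
      then show "?x - p (g + 2 * t + 1)
          \<le> evens1 s1 - evens1 s' + odds1 (Suc s') + (evens1 L1 - evens1 (Suc t)) + rest"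
        using L2[of t s'] less.prems unfolding pB s S by simp
    qed (use less.prems assms(5) s in auto)
    moreover have "2 * (L1 - Suc t + L2 + L3 + 2 + s1) = r" using tL by (auto simp: r_def s)
    ultimately show ?thesis by simp
  qed
  have r: "2 * (L1 - t + L2 + L3 + 1 + s) = Suc (Suc r)" by (simp add: r_def)
  show ?case unfolding r secures.simps using left right by (simp add: numeral_3_eq_3)
qed

end

section \<open>The gain from one block\<close>

lemma alt_sum_mono:
  assumes "\<And>k. 0 \<le> p k" "i \<le> j"
  shows "alt_sum p a i \<le> alt_sum p a j"
proof -
  have "alt_sum p a j = alt_sum p a i + alt_sum p (a + 2 * i) (j - i)"
    by (rule alt_sum_split) (use assms in auto)
  then show ?thesis using alt_sum_nonneg[of p "a + 2 * i" "j - i"] assms by simp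
qed

context blocks
begin

text \<open>Alice starts with the only even slice \<open>g + 1\<close>; Bob's first answer already
  takes an end of the block, so she jumps at once.\<close>

lemma one_jump_gain:
  assumes "L1 = 1" "\<And>k. 0 \<le> p k" "x \<le> p (g + 1) + rest"
  shows "\<exists>z. secures p 1 (z + 1) (n - 1) (x - p z)"
proof -
  have "secures p (Suc 0) (g + 2 * 1) (2 * (L1 - 1 + L2 + L3 + 2 + 0)) (x - p (g + 1))"
  proof (rule secures_one_jump)
    fix t' assume "1 \<le> t'" "t' \<le> L1"
    then have "t' = 1" using assms(1) by simp
    then show "x - p (g + 1) \<le> evens1 t' - evens1 1 + (odds1 (Suc L1) - odds1 t') + evens1 0 + rest"
      using assms alt_sum_mono[of p "Suc 0" "Suc (Suc 0)" g] by simp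
  next
    fix s' :: nat assume "s' \<le> 0"
    then show "x - p (g + 1) \<le> evens1 0 - evens1 s' + odds1 (Suc s') + (evens1 L1 - evens1 1) + rest"
      using assms by (simp add: alt_sum_Suc add_increasing)
  qed (use assms in auto)
  moreover have "2 * (L1 - 1 + L2 + L3 + 2 + 0) = n - 1" using assms(1) by (simp add: n_eq)
  ultimately show ?thesis by (intro exI[of _ "g + 1"]) simp
qed

text \<open>If some even slice is a good start, one jump suffices. Otherwise the failures enclose
  the weighted median of the odd slices; Alice starts there and takes the worst failures on both
  sides as thresholds \<open>S\<close> and \<open>T\<close>.\<close>

lemma two_jump_gain:
  assumes L1: "0 < L1" and nonneg: "\<And>k. 0 \<le> p k"
    and eb: "odds1 (Suc L1) \<le> evens1 L1"
    and x: "x \<le> evens1 L1 / 2 + odds1 (Suc L1) / 4 + rest"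
  shows "\<exists>z. secures p 2 (z + 1) (n - 1) (x - p z)"
proof -
  define \<theta> where "\<theta> = x - rest"
  define b e where "b = evens1 L1" and "e = odds1 (Suc L1)"
  \<comment> \<open>\<open>\<phi> t\<close> is Alice's income in the block if she has kept to even
    slices and Bob takes \<open>g\<close> when the arc starts at \<open>g + 2 * t\<close>;
    \<open>\<psi> s\<close> is the mirror image.\<close>
  define \<phi> where "\<phi> t = evens1 t + e - odds1 t" for t
  define \<psi> where "\<psi> s = b - evens1 s + odds1 (Suc s)" for s
  have \<theta>: "\<theta> \<le> b / 2 + e / 4" using x by (simp add: \<theta>_def b_def e_def)
  have evm: "i \<le> j \<Longrightarrow> evens1 i \<le> evens1 j" and odm: "i \<le> j \<Longrightarrow> odds1 i \<le> odds1 j" for i j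
    using alt_sum_mono[of p i j] nonneg by auto
  have be0: "0 \<le> e" "e \<le> b" using eb alt_sum_nonneg[of p g] nonneg by (auto simp: b_def e_def)
  have pB: "p (g + 2 * k + 1) = evens1 (Suc k) - evens1 k" for k
    by (simp add: alt_sum_Suc ac_simps)
  have pE: "p (g + 2 * k) = odds1 (Suc k) - odds1 k" for k
    by (simp add: alt_sum_Suc)
  show ?thesis
  proof (cases "\<exists>k<L1. (\<forall>t. k < t \<longrightarrow> t \<le> L1 \<longrightarrow> \<theta> \<le> \<phi> t) \<and> (\<forall>s\<le>k. \<theta> \<le> \<psi> s)")
    case True
    then obtain k where k: "k < L1" "\<And>t. k < t \<Longrightarrow> t \<le> L1 \<Longrightarrow> \<theta> \<le> \<phi> t" "\<And>s. s \<le> k \<Longrightarrow> \<theta> \<le> \<psi> s"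
      by blast
    have "secures p (Suc 1) (g + 2 * Suc k) (2 * (L1 - Suc k + L2 + L3 + 2 + k)) (x - p (g + 2 * k + 1))"
    proof (rule secures_one_jump)
      fix t' assume "Suc k \<le> t'" "t' \<le> L1"
      then show "x - p (g + 2 * k + 1)
          \<le> evens1 t' - evens1 (Suc k) + (odds1 (Suc L1) - odds1 t') + evens1 k + rest"
        using k(2)[of t'] unfolding pB by (simp add: \<phi>_def \<theta>_def e_def)
    next
      fix s' assume "s' \<le> k"
      then show "x - p (g + 2 * k + 1)
          \<le> evens1 k - evens1 s' + odds1 (Suc s') + (evens1 L1 - evens1 (Suc k)) + rest"
        using k(3)[of s'] unfolding pB by (simp add: \<psi>_def \<theta>_def b_def)
    qed (use k in auto)
    moreover have "2 * (L1 - Suc k + L2 + L3 + 2 + k) = n - 1" using k(1) by (simp add: n_eq)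
    ultimately show ?thesis
      by (intro exI[of _ "g + 2 * k + 1"]) (simp add: numeral_2_eq_2)
  next
    case False
    have sum: "\<phi> j + \<psi> j = b + e + p (g + 2 * j)" for j
      unfolding pE by (simp add: \<phi>_def \<psi>_def)
    have same: "\<not> (\<phi> j < \<theta> \<and> \<psi> j < \<theta>)" for j
      using sum[of j] nonneg[of "g + 2 * j"] \<theta> be0 by argo
    text \<open>A failure of both kinds with \<open>S < T\<close> forces more than half of the odd slices to lie strictly
      between, so the weighted median of the odd slices does.\<close>
    have key: "e / 2 < odds1 T - odds1 (Suc S)" if "S < T" "\<phi> T < \<theta>" "\<psi> S < \<theta>" for S T
    proof -
      have "evens1 S \<le> evens1 T" using evm that(1) by simp
      then show ?thesis using that(2,3) \<theta> unfolding \<phi>_def \<psi>_def by linarith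
    qed
    \<comment> \<open>The last failure of \<open>\<phi>\<close>, with 0 as default. Starting with
      even slice \<open>T0\<close> meets no later failure of \<open>\<phi>\<close>; as this start is
      bad too, \<open>\<psi>\<close> fails at some \<open>S0 \<le> T0\<close>.\<close>
    define T0 where "T0 = Max (insert 0 {t. t \<le> L1 \<and> \<phi> t < \<theta>})"
    have fin: "finite (insert 0 {t. t \<le> L1 \<and> \<phi> t < \<theta>})" by simp
    have T0: "T0 = 0 \<or> T0 \<le> L1 \<and> \<phi> T0 < \<theta>" using Max_in[OF fin] unfolding T0_def by blast
    have T0_ge: "t \<le> T0" if "t \<le> L1" "\<phi> t < \<theta>" for t
      unfolding T0_def using that fin by (intro Max_ge) auto
    have "\<theta> \<le> \<phi> L1"
      using \<theta> be0 pE[of L1] nonneg[of "g + 2 * L1"] by (simp add: \<phi>_def b_def e_def)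
    then have "T0 < L1" using T0 L1 by (metis le_neq_implies_less not_le)
    moreover have "\<theta> \<le> \<phi> t" if "T0 < t" "t \<le> L1" for t
      using T0_ge[of t] that by force
    ultimately obtain S0 where S0: "S0 \<le> T0" "\<psi> S0 < \<theta>" using False by (meson not_le)
    have "\<theta> \<le> \<psi> 0"
      using \<theta> be0 nonneg[of g] by (simp add: \<psi>_def alt_sum_Suc)
    then have "S0 \<noteq> 0" using S0(2) by (metis not_le)
    then have T0': "T0 \<le> L1" "\<phi> T0 < \<theta>" using T0 S0 by auto
    have "S0 < T0" using S0 T0' same[of T0] by (metis le_neq_implies_less)
    \<comment> \<open>The weighted median: the odd slices before \<open>\<mu>\<close> weigh at most
      \<open>e / 2\<close>, and so do those after it.\<close>
    define \<mu> where "\<mu> = Max {i. i \<le> L1 \<and> odds1 i \<le> e / 2}"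
    have fin': "finite {i. i \<le> L1 \<and> odds1 i \<le> e / 2}" by simp
    have "0 \<in> {i. i \<le> L1 \<and> odds1 i \<le> e / 2}" using be0 by simp
    then have \<mu>: "\<mu> \<le> L1" "odds1 \<mu> \<le> e / 2" using Max_in[OF fin'] unfolding \<mu>_def by blast+
    have \<mu>_max: "i \<le> \<mu>" if "i \<le> L1" "odds1 i \<le> e / 2" for i
      unfolding \<mu>_def using that fin' by (intro Max_ge) auto
    have \<mu>': "e - odds1 (Suc \<mu>) \<le> e / 2"
    proof (cases "\<mu> = L1")
      case True then show ?thesis using be0 by (simp add: e_def)
    next
      case False
      then show ?thesis using \<mu>_max[of "Suc \<mu>"] \<mu>(1) by (cases "odds1 (Suc \<mu>) \<le> e / 2") auto
    qed
    have between: "S < \<mu> \<and> \<mu> < T" if "S < T" "T \<le> L1" "\<phi> T < \<theta>" "\<psi> S < \<theta>" for S T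
    proof -
      have "\<not> \<mu> \<le> S"
        using key[OF that(1,3,4)] \<mu>' odm[of "Suc \<mu>" "Suc S"] odm[of T "Suc L1"] that(2)
        by (auto simp: e_def)
      moreover have "\<not> T \<le> \<mu>"
        using key[OF that(1,3,4)] \<mu>(2) odm[of T \<mu>] alt_sum_nonneg[of p g "Suc S"] nonneg by force
      ultimately show ?thesis by simp
    qed
    have S0T0: "S0 < \<mu>" "\<mu> < T0" using between[OF \<open>S0 < T0\<close> T0' S0(2)] by auto
    \<comment> \<open>The minimal values of \<open>\<phi>\<close> and \<open>\<psi>\<close> on the
      two sides of the median; replacing \<open>\<phi> T\<close> by \<open>\<phi> t'\<close> or
      \<open>\<psi> S\<close> by \<open>\<psi> s'\<close> then never loses anything.\<close>
    obtain T where T: "\<mu> \<le> T" "T \<le> L1" "\<And>t. \<mu> \<le> t \<Longrightarrow> t \<le> L1 \<Longrightarrow> \<phi> T \<le> \<phi> t"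
      using ex_min_if_finite[of "\<phi> ` {\<mu>..L1}"] \<mu>(1) by (auto simp: not_less) 
    obtain S where S: "S \<le> \<mu>" "\<And>s. s \<le> \<mu> \<Longrightarrow> \<psi> S \<le> \<psi> s"
      using ex_min_if_finite[of "\<psi> ` {..\<mu>}"] by (auto simp: not_less)
    have T\<theta>: "\<phi> T < \<theta>" using T(3)[of T0] S0T0 T0' by simp
    have S\<theta>: "\<psi> S < \<theta>" using S(2)[of S0] S0T0 S0 by simp
    have "S < T" using S(1) T(1) same[of T] T\<theta> S\<theta> by (metis le_trans le_neq_implies_less)
    have ST: "S < \<mu>" "\<mu> < T" using between[OF \<open>S < T\<close> T(2) T\<theta> S\<theta>] by auto
    \<comment> \<open>A failure of \<open>\<phi>\<close> at \<open>s\<close> would pair with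
      \<open>S\<close>, so \<open>between\<close> would place \<open>s\<close> beyond
      \<open>\<mu>\<close>.\<close>
    have \<phi>s: "\<theta> \<le> \<phi> s" if "S < s" "s \<le> \<mu>" for s
      using between[of S s] that S\<theta> \<mu>(1) by force
    have \<psi>t: "\<theta> \<le> \<psi> t" if "\<mu> \<le> t" "t < T" for t
      using between[of t T] that T\<theta> T(2) by force
    \<comment> \<open>Up to \<open>rest\<close>, the four incomes are
      \<open>\<phi> s + \<phi> t' - \<phi> T\<close>,
      \<open>\<psi> s' + \<phi> s - \<phi> T\<close>, \<open>\<phi> t' + \<psi> t - \<psi> S\<close>
      and \<open>\<psi> t + \<psi> s' - \<psi> S\<close>. The choice of \<open>T\<close> and
      \<open>S\<close> bounds the outer two, the median property the two mixed ones.\<close>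
    have "secures p (Suc (Suc 0)) (g + 2 * \<mu> + 1) (2 * (L1 - \<mu> + L2 + L3 + 1 + \<mu>))
      (x - (odds1 (Suc \<mu>) - odds1 \<mu>))"
    proof (rule secures_two_jumps[of S \<mu> \<mu> \<mu> T])
      fix s t' assume "S < s" "s \<le> \<mu>" "T \<le> t'" "t' \<le> L1"
      then show "x \<le> odds1 T - odds1 s + evens1 s + evens1 t' - evens1 T + (odds1 (Suc L1) - odds1 t') + rest"
        using \<phi>s[of s] T(3)[of t'] T(1) unfolding \<phi>_def \<theta>_def e_def by simp
    next
      fix s s' assume s: "S < s" "s \<le> \<mu>" "s' < s"
      have "\<theta> + \<phi> T \<le> \<psi> s' + \<phi> s"
        using T\<theta> \<theta> s evm[of s' s] odm[of s \<mu>] \<mu>(2) alt_sum_nonneg[of p g "Suc s'"] nonneg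
        unfolding \<phi>_def \<psi>_def by force
      then show "x \<le> odds1 T - odds1 s + evens1 s - evens1 s' + odds1 (Suc s') + (evens1 L1 - evens1 T) + rest"
        unfolding \<phi>_def \<psi>_def \<theta>_def b_def by simp
    next
      fix t t' assume t: "\<mu> \<le> t" "t < T" "t < t'" "t' \<le> L1"
      have "odds1 t' \<le> e" using odm[of t' "Suc L1"] t by (simp add: e_def)
      then have "\<theta> + \<psi> S \<le> \<phi> t' + \<psi> t"
        using S\<theta> \<theta> t evm[of t t'] odm[of "Suc \<mu>" "Suc t"] \<mu>'
        unfolding \<phi>_def \<psi>_def by force
      then show "x \<le> odds1 (Suc t) - odds1 (Suc S) + evens1 t' - evens1 t + evens1 S + (odds1 (Suc L1) - odds1 t') + rest"
        unfolding \<phi>_def \<psi>_def \<theta>_def e_def by simp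
    next
      fix t s' assume "\<mu> \<le> t" "t < T" "s' \<le> S"
      then show "x \<le> odds1 (Suc t) - odds1 (Suc S) + evens1 S - evens1 s' + odds1 (Suc s') + (evens1 L1 - evens1 t) + rest"
        using \<psi>t[of t] S(2)[of s'] S(1) unfolding \<psi>_def \<theta>_def b_def by simp
    qed (use ST T in auto)
    moreover have "2 * (L1 - \<mu> + L2 + L3 + 1 + \<mu>) = n - 1" using \<mu>(1) by (simp add: n_eq)
    moreover have "Suc (Suc 0) = 2" by simp
    ultimately have "secures p 2 (g + 2 * \<mu> + 1) (n - 1) (x - p (g + 2 * \<mu>))"
      by (simp only: pE)
    then show ?thesis by blast
  qed
qed

end

section \<open>Half circles and minimal cuts\<close>

locale odd_circle =
  fixes p :: "nat \<Rightarrow> real" and n m :: nat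
  assumes periodic: "p (k + n) = p k"
    and nonneg: "0 \<le> p k"
    and n_eq: "n = 2 * m + 1"
begin

text \<open>As \<open>n\<close> is odd, the first slice \<open>y\<close> and the last one
  \<open>y + 2 * m\<close> are neighbours modulo \<open>n\<close>; the gap lies between
  them.\<close>

definition half :: "nat \<Rightarrow> real" where
  "half y = alt_sum p y (Suc m)"

definition total :: real where
  "total = (\<Sum>k<n. p k)"

lemma alt_sum_per: "alt_sum p (a + n) k = alt_sum p a k"
  by (rule alt_sum_periodic) (rule periodic)

lemma half_per: "half (y + n) = half y"
  by (simp add: half_def alt_sum_per)

lemma half_mod: "half (y mod n + c) = half (y + c)"
proof -
  have "half (y' + c + q * n) = half (y' + c)" for q y'
  proof (induction q)
    case (Suc q)
    then show ?case using half_per[of "y' + c + q * n"] by (simp add: ac_simps)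
  qed simp
  from this[of "y mod n" "y div n"] show ?thesis
    using mod_mult_div_eq[of y n] by (simp add: ac_simps)
qed

text \<open>The complement at \<open>y\<close> together with slice \<open>y\<close> is the half
  circle at \<open>y + 1\<close>, so the sum does not change with \<open>y\<close>.\<close>

lemma total_eq: "total = half y + alt_sum p (y + 1) m"
proof -
  have *: "(\<Sum>k<2 * j + 1. p k) = alt_sum p 0 (Suc j) + alt_sum p 1 j" for j
    by (induction j) (simp_all add: alt_sum_Suc)
  show ?thesis
  proof (induction y)
    case 0
    show ?case using *[of m] unfolding total_def half_def n_eq[symmetric] by simp
  next
    case (Suc y)
    have "p (y + 1 + 2 * m) = p y" using periodic[of y] by (simp add: n_eq ac_simps)
    then have "half (Suc y) = alt_sum p (y + 1) m + p y" by (simp add: half_def alt_sum_Suc)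
    moreover have "half y = p y + alt_sum p (y + 2) m" by (simp add: half_def alt_sum_head)
    ultimately show ?case using Suc by simp
  qed
qed

lemma half_shift:
  assumes "i \<le> m"
  shows "half (y + 2 * i) = half y - alt_sum p y i + alt_sum p (y + 1) i"
proof -
  have "half y = alt_sum p y i + alt_sum p (y + 2 * i) (Suc m - i)"
    unfolding half_def by (rule alt_sum_split) (use assms in auto)
  moreover have "half (y + 2 * i) = alt_sum p (y + 2 * i) (Suc m - i) + alt_sum p (y + 1 + n) i"
    unfolding half_def by (rule alt_sum_split) (use assms in \<open>auto simp: n_eq\<close>)
  ultimately show ?thesis using alt_sum_per[of "y + 1" i] by simp
qed

text \<open>With \<open>i\<close> pairs eaten from the left, pure shifting from \<open>z\<close>
  ends with the half circle at \<open>z + 1 + 2 * i\<close>; for \<open>i \<le> m\<close> these are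
  exactly the half circles containing \<open>z\<close>.\<close>

lemma zero_jump_gain:
  assumes "\<And>i. i \<le> m \<Longrightarrow> x \<le> half (z + 1 + 2 * i)"
  shows "secures p 0 (z + 1) (n - 1) (x - p z)"
proof -
  have "secures p 0 (z + 1) (2 * m) (x - p z)"
  proof (rule secures_follow)
    fix i assume i: "i \<le> m"
    have "half (z + 1 + 2 * i) = alt_sum p (z + 1 + 2 * i) (m - i) + alt_sum p (z + n) (Suc i)"
      unfolding half_def by (rule alt_sum_split) (use i in \<open>auto simp: n_eq\<close>)
    also have "alt_sum p (z + n) (Suc i) = p z + alt_sum p (z + 2) i" by (subst alt_sum_per) (rule alt_sum_head)
    finally show "x - p z \<le> alt_sum p (z + 1 + 1) i + alt_sum p (z + 1 + 2 * i) (m - i)"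
      using assms[OF i] by simp
  qed
  then show ?thesis by (simp add: n_eq)
qed

section \<open>Cuts by three light half circles\<close>

definition cut :: "real \<Rightarrow> nat \<times> nat \<times> nat \<times> nat \<Rightarrow> bool" where
  "cut \<theta> = (\<lambda>(g, L1, L2, L3). n = 2 * L1 + 2 * L2 + 2 * L3 + 3 \<and> half g < \<theta>
    \<and> half (g + 2 * L1 + 1) < \<theta> \<and> half (g + 2 * L1 + 2 * L2 + 2) < \<theta>)"

definition cut_size :: "nat \<times> nat \<times> nat \<times> nat \<Rightarrow> real" where
  "cut_size = (\<lambda>(g, L1, L2, L3). half g + half (g + 2 * L1 + 1) + half (g + 2 * L1 + 2 * L2 + 2))"

definition minimal_cut :: "real \<Rightarrow> nat \<times> nat \<times> nat \<times> nat \<Rightarrow> bool" where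
  "minimal_cut \<theta> c \<longleftrightarrow> cut \<theta> c \<and> (\<forall>c'. cut \<theta> c' \<longrightarrow> cut_size c \<le> cut_size c')"

text \<open>Seen from a light gap \<open>g\<close>, a cut needs a light gap at odd distance followed
  by one at even distance. The best candidates are the earliest odd distance and the latest even
  one.\<close>

lemma cut_exists:
  assumes cover: "\<And>z. \<exists>i\<le>m. half (z + 1 + 2 * i) < \<theta>" and \<theta>: "2 * \<theta> \<le> total"
  shows "\<exists>c. cut \<theta> c"
proof -
  obtain g where g: "half g < \<theta>" using cover by blast
  define E where "E = {y. y \<le> n \<and> even y \<and> half (g + y) < \<theta>}"
  define D where "D = {y. y \<le> n \<and> odd y \<and> half (g + y) < \<theta>}"
  have fin: "finite E" "finite D" by (auto simp: E_def D_def)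
  have "0 \<in> E" using g by (simp add: E_def)
  moreover have "n \<in> D" using g by (simp add: D_def half_per) (simp add: n_eq)
  ultimately have ne: "E \<noteq> {}" "D \<noteq> {}" by auto
  define y3 y2 where "y3 = Max E" and "y2 = Min D"
  have y3: "y3 \<le> n" "even y3" "half (g + y3) < \<theta>" and y2: "y2 \<le> n" "odd y2" "half (g + y2) < \<theta>"
    using Max_in[OF fin(1) ne(1)] Min_in[OF fin(2) ne(2)] by (auto simp: y3_def y2_def E_def D_def)
  have y3_max: "y \<le> y3" if "y \<in> E" for y unfolding y3_def using that fin by simp
  have y2_min: "y2 \<le> y" if "y \<in> D" for y unfolding y2_def using that fin by simp
  have "y2 < y3"
  proof (rule ccontr)
    assume "\<not> y2 < y3"
    then have lt: "y3 < y2" using y3 y2 by (metis linorder_neqE_nat)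
    show False
    proof (cases "y2 = y3 + 1")
      case True
      \<comment> \<open>The half circles of two consecutive gaps cover the circle and share one
        slice, so they cannot both be light.\<close>
      have "half (g + y3 + 1) = alt_sum p (g + y3 + 1) m + p (g + y3)"
        using periodic[of "g + y3"] by (simp add: half_def alt_sum_Suc n_eq ac_simps)
      then have "total \<le> half (g + y3) + half (g + y3 + 1)"
        using total_eq[of "g + y3"] nonneg[of "g + y3"] by simp
      then show False using y3 y2 True \<theta> by simp
    next
      case False
      \<comment> \<open>Slice \<open>g + y3 + 1\<close> lies in a light half circle, at even
        distance \<open>w\<close> beyond \<open>y3\<close>. Either \<open>w\<close> contradicts the
        choice of \<open>y3\<close>, or a full turn, which flips the parity, makes
        \<open>w - n\<close> contradict that of \<open>y2\<close>.\<close>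
      obtain i where i: "i \<le> m" "half (g + y3 + 1 + 1 + 2 * i) < \<theta>" using cover[of "g + y3 + 1"] by blast
      define w where "w = y3 + 2 + 2 * i"
      have "g + w = g + y3 + 1 + 1 + 2 * i" by (simp add: w_def)
      then have w: "half (g + w) < \<theta>" "even w" using i(2) y3(2) by (simp_all only:) (simp add: w_def)
      show False
      proof (cases "w \<le> n")
        case True
        then have "w \<in> E" using w by (simp add: E_def)
        then show False using y3_max[of w] by (simp add: w_def)
      next
        case False
        then have "g + w = g + (w - n) + n" by simp
        then have "half (g + (w - n)) < \<theta>" using w half_per by metis
        moreover have "odd (w - n)" using w False by (auto simp: n_eq)
        moreover have "w - n \<le> y3 + 1" using i by (simp add: w_def n_eq)
        ultimately have "w - n \<in> D" using lt y2(1) by (simp add: D_def)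
        then show False using y2_min[of "w - n"] \<open>w - n \<le> y3 + 1\<close> lt \<open>y2 \<noteq> y3 + 1\<close> by simp
      qed
    qed
  qed
  obtain L1 where L1: "y2 = 2 * L1 + 1" using y2 by (auto elim: oddE)
  have "even (y3 - y2 - 1)" "y3 \<noteq> n" using \<open>y2 < y3\<close> y2 y3 by (auto simp: n_eq)
  then obtain L2 where "y3 - y2 - 1 = 2 * L2" by blast
  then have L2: "y3 = 2 * L1 + 2 * L2 + 2" using L1 \<open>y2 < y3\<close> by simp
  have "even (n - y3 - 1)" using y3 \<open>y3 \<noteq> n\<close> by (auto simp: n_eq)
  then obtain L3 where "n - y3 - 1 = 2 * L3" by blast
  then have "n = 2 * L1 + 2 * L2 + 2 * L3 + 3" using L2 y3(1) \<open>y3 \<noteq> n\<close> by simp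
  then have "cut \<theta> (g, L1, L2, L3)"
    using g y2(3) y3(3) unfolding cut_def prod.case L1 L2 by (simp add: ac_simps)
  then show ?thesis by blast
qed

text \<open>Gaps matter only modulo \<open>n\<close>, so only finitely many cuts have to be
  compared.\<close>

lemma minimal_cut_exists:
  assumes "\<exists>c. cut \<theta> c"
  shows "\<exists>c. minimal_cut \<theta> c"
proof -
  define C where "C = {c. cut \<theta> c \<and> fst c < n}"
  have red: "\<exists>c'\<in>C. cut_size c' = cut_size c" if c: "cut \<theta> c" for c
  proof -
    obtain g L1 L2 L3 where c_eq: "c = (g, L1, L2, L3)" by (cases c)
    have "half (g mod n) = half g" "half (g mod n + 2 * L1 + 1) = half (g + 2 * L1 + 1)"
      "half (g mod n + 2 * L1 + 2 * L2 + 2) = half (g + 2 * L1 + 2 * L2 + 2)"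
      using half_mod[of g 0] half_mod[of g "2 * L1 + 1"] half_mod[of g "2 * L1 + 2 * L2 + 2"]
      by (simp_all add: add.assoc)
    then have "cut \<theta> (g mod n, L1, L2, L3)" "cut_size (g mod n, L1, L2, L3) = cut_size c"
      using c unfolding cut_def cut_size_def c_eq prod.case by metis+
    then show ?thesis by (intro bexI[of _ "(g mod n, L1, L2, L3)"]) (auto simp: C_def n_eq)
  qed
  have "C \<subseteq> {..n} \<times> {..n} \<times> {..n} \<times> {..n}" by (auto simp: C_def cut_def)
  then have "finite C" by (rule finite_subset) auto
  moreover have "C \<noteq> {}" using assms red by blast
  ultimately obtain c where "c \<in> C" "\<And>c'. c' \<in> C \<Longrightarrow> cut_size c \<le> cut_size c'"
    using ex_min_if_finite[of "cut_size ` C"] by (force simp: not_less)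
  then have "minimal_cut \<theta> c" using red by (fastforce simp: minimal_cut_def C_def)
  then show ?thesis by blast
qed

text \<open>This carries statements on the first block over to the other two.\<close>

lemma minimal_cut_rotate:
  assumes "minimal_cut \<theta> (g, L1, L2, L3)"
  shows "minimal_cut \<theta> (g + 2 * L1 + 1, L2, L3, L1)"
proof -
  have n: "n = 2 * L1 + 2 * L2 + 2 * L3 + 3" using assms by (simp add: minimal_cut_def cut_def)
  have e: "g + 2 * L1 + 1 + 2 * L2 + 2 * L3 + 2 = g + n"
    "g + 2 * L1 + 1 + 2 * L2 + 1 = g + 2 * L1 + 2 * L2 + 2" by (simp_all add: n)
  have "cut \<theta> (g + 2 * L1 + 1, L2, L3, L1)"
    using assms unfolding minimal_cut_def cut_def prod.case e half_per by simp
  moreover have "cut_size (g + 2 * L1 + 1, L2, L3, L1) = cut_size (g, L1, L2, L3)"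
    unfolding cut_size_def prod.case e half_per by simp
  ultimately show ?thesis using assms unfolding minimal_cut_def by simp
qed

text \<open>Moving the second gap of a minimal cut by an even distance gives another cut, which is not smaller.\<close>

lemma minimal_cut_shift:
  assumes c: "minimal_cut \<theta> (g, L1, L2, L3)"
  shows "i \<le> L2 \<Longrightarrow> alt_sum p (g + 2 * L1 + 1) i \<le> alt_sum p (g + 2 * L1 + 2) i"
    and "i \<le> L1 \<Longrightarrow> alt_sum p (g + 2 * i + 2) (L1 - i) \<le> alt_sum p (g + 2 * i + 1) (L1 - i)"
proof -
  have cut: "cut \<theta> (g, L1, L2, L3)" and min: "\<And>c'. cut \<theta> c' \<Longrightarrow> cut_size (g, L1, L2, L3) \<le> cut_size c'"
    using c by (auto simp: minimal_cut_def)
  have n: "n = 2 * L1 + 2 * L2 + 2 * L3 + 3" using cut by (simp add: cut_def)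
  let ?g2 = "g + 2 * L1 + 1"
  \<comment> \<open>If the moved half circle is not light, it is larger than the old one anyway;
    otherwise minimality applies.\<close>
  have le: "half ?g2 \<le> half (g + 2 * L1' + 1)" if "L1' + L2' = L1 + L2" for L1' L2'
  proof (cases "half (g + 2 * L1' + 1) < \<theta>")
    case True
    have eq: "2 * L1' + 2 * L2' = 2 * L1 + 2 * L2" using that by simp
    then have h: "half (g + 2 * L1' + 2 * L2' + 2) = half (g + 2 * L1 + 2 * L2 + 2)"
      by (metis add.assoc)
    then have "cut \<theta> (g, L1', L2', L3)"
      using cut True eq unfolding cut_def prod.case h by simp
    from min[OF this] show ?thesis
      using h unfolding cut_size_def prod.case by linarith
  next
    case False
    then show ?thesis using cut by (simp add: cut_def)
  qed
  show "alt_sum p (g + 2 * L1 + 1) i \<le> alt_sum p (g + 2 * L1 + 2) i" if "i \<le> L2"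
    using le[of "L1 + i" "L2 - i"] half_shift[of i ?g2] that n n_eq by (simp add: ac_simps)
  show "alt_sum p (g + 2 * i + 2) (L1 - i) \<le> alt_sum p (g + 2 * i + 1) (L1 - i)" if "i \<le> L1"
  proof -
    have "g + 2 * i + 1 + 2 * (L1 - i) = ?g2" using that by simp
    moreover have "L1 - i \<le> m" using n n_eq by simp
    from half_shift[OF this, of "g + 2 * i + 1"] have "half (g + 2 * i + 1 + 2 * (L1 - i)) = half (g + 2 * i + 1) - alt_sum p (g + 2 * i + 1) (L1 - i)
        + alt_sum p (g + 2 * i + 2) (L1 - i)" by simp
    ultimately show ?thesis using le[of i "L2 + (L1 - i)"] that by (simp only:) simp
  qed
qed

text \<open>Domination of prefixes comes from advancing the gap at the start of a block, that of
  suffixes from moving back the gap at its end.\<close>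

lemma minimal_cut_blocks:
  assumes c: "minimal_cut \<theta> (g, L1, L2, L3)"
  shows "blocks p n g L1 L2 L3"
proof
  show "p (k + n) = p k" for k by (rule periodic)
  show n: "n = 2 * L1 + 2 * L2 + 2 * L3 + 3" using c by (simp add: minimal_cut_def cut_def)
  note c2 = minimal_cut_rotate[OF c]
  note c3 = minimal_cut_rotate[OF c2]
  have e: "g + 2 * L1 + 1 + 2 * L2 + 1 + 2 * L3 + 1 = g + n"
    "g + 2 * L1 + 1 + 2 * L2 + 1 + 2 * L3 + 2 = g + 1 + n" by (simp_all add: n)
  show "dominated p g L1"
    using minimal_cut_shift(1)[OF c3, unfolded e alt_sum_per] minimal_cut_shift(2)[OF c]
    unfolding dominated_def by blast
  show "dominated p (g + 2 * L1 + 1) L2"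
    unfolding dominated_def
    using minimal_cut_shift(1)[OF c] minimal_cut_shift(2)[OF c2] by (simp add: ac_simps)
  show "dominated p (g + 2 * L1 + 2 * L2 + 2) L3"
    unfolding dominated_def
    using minimal_cut_shift(1)[OF c2] minimal_cut_shift(2)[OF c3] by (simp add: ac_simps)
qed

end

section \<open>Gains on odd circles\<close>

context odd_circle
begin

text \<open>Blocks have odd length, so a half circle at one of the gaps alternates between odd and
  even slices at the two other gaps and has odd slices on both sides of its own.\<close>

lemma minimal_cut_sums:
  assumes c: "minimal_cut \<theta> (g, L1, L2, L3)"
  defines "b \<equiv> alt_sum p (g + 1) L1" and "e \<equiv> alt_sum p g (Suc L1)"
    and "c \<equiv> alt_sum p (g + 2 * L1 + 1) (Suc L2)" and "f \<equiv> alt_sum p (g + 2 * L1 + 2) L2"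
    and "a \<equiv> alt_sum p (g + 2 * L1 + 2 * L2 + 2) (Suc L3)" and "d \<equiv> alt_sum p (g + 2 * L1 + 2 * L2 + 3) L3"
  shows "e + f + a < \<theta>" "c + d + e < \<theta>" "a + b + c < \<theta>" "total = a + b + c + d + e + f"
    and "blocks.rest p g L1 L2 L3 = min (c + d) (f + a)"
proof -
  have cut: "cut \<theta> (g, L1, L2, L3)" using c by (simp add: minimal_cut_def)
  then have nL: "n = 2 * L1 + 2 * L2 + 2 * L3 + 3" by (simp add: cut_def)
  then have m: "m = L1 + L2 + L3 + 1" using n_eq by simp
  have h: "half g < \<theta>" "half (g + 2 * L1 + 1) < \<theta>" "half (g + 2 * L1 + 2 * L2 + 2) < \<theta>"
    using cut by (simp_all add: cut_def)
  have s1: "half g = e + alt_sum p (g + 2 * L1 + 2) (L2 + Suc L3)"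
    unfolding half_def e_def by (rule alt_sum_split) (auto simp: m)
  have s1': "alt_sum p (g + 2 * L1 + 2) (L2 + Suc L3) = f + a"
    unfolding f_def a_def by (rule alt_sum_split) auto
  have s2: "half (g + 2 * L1 + 1) = c + alt_sum p (g + 2 * L1 + 2 * L2 + 3) (L3 + Suc L1)"
    unfolding half_def c_def by (rule alt_sum_split) (auto simp: m)
  have s2': "alt_sum p (g + 2 * L1 + 2 * L2 + 3) (L3 + Suc L1) = d + alt_sum p (g + n) (Suc L1)"
    unfolding d_def by (rule alt_sum_split) (auto simp: nL)
  have s3: "half (g + 2 * L1 + 2 * L2 + 2) = a + alt_sum p (g + 1 + n) (L1 + Suc L2)"
    unfolding half_def a_def by (rule alt_sum_split) (auto simp: m nL)
  have s3': "alt_sum p (g + 1) (L1 + Suc L2) = b + c"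
    unfolding b_def c_def by (rule alt_sum_split) auto
  have t: "alt_sum p (g + 1) m = b + alt_sum p (g + 2 * L1 + 1) (Suc L2 + L3)"
    unfolding b_def by (rule alt_sum_split) (auto simp: m)
  have t': "alt_sum p (g + 2 * L1 + 1) (Suc L2 + L3) = c + d"
    unfolding c_def d_def by (rule alt_sum_split) auto
  show efa: "e + f + a < \<theta>" using h(1) s1 s1' by simp
  show "c + d + e < \<theta>" using h(2) s2 s2' alt_sum_per[of g "Suc L1"] by (simp add: e_def)
  show "a + b + c < \<theta>" using h(3) s3 s3' alt_sum_per[of "g + 1"] by simp
  show "total = a + b + c + d + e + f" using total_eq[of g] s1 s1' t t' by simp
  show "blocks.rest p g L1 L2 L3 = min (c + d) (f + a)"
    unfolding blocks.rest_def[OF minimal_cut_blocks[OF c]]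
    by (simp add: c_def d_def f_def a_def add.assoc numeral_3_eq_3)
qed

lemma cut_or_zero_jump:
  assumes "2 * \<theta> \<le> total"
  shows "(\<exists>z. secures p 0 (z + 1) (n - 1) (\<theta> - p z)) \<or> (\<exists>c. minimal_cut \<theta> c)"
  using zero_jump_gain[of \<theta>] cut_exists[OF _ assms] minimal_cut_exists by (metis not_le)

text \<open>Adding the two half circles that contain \<open>e\<close> gives
  \<open>2 * e + a + c + d + f < total\<close>, hence \<open>e < b\<close>.\<close>

lemma minimal_cut_lengths:
  assumes c: "minimal_cut \<theta> (g, L1, L2, L3)" and \<theta>: "2 * \<theta> \<le> total"
  shows "0 < L1" "alt_sum p g (Suc L1) \<le> alt_sum p (g + 1) L1"
proof -
  note s = minimal_cut_sums[OF c]
  show le: "alt_sum p g (Suc L1) \<le> alt_sum p (g + 1) L1" using s(1,2,4) \<theta> by argo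
  show "0 < L1"
  proof (rule ccontr)
    assume "\<not> 0 < L1"
    then have "alt_sum p (g + 1) L1 = 0" by simp
    moreover have "0 \<le> alt_sum p g (Suc L1)" using nonneg by (rule alt_sum_nonneg)
    ultimately show False using s(1,2,4) \<theta> by argo
  qed
qed

lemma zero_jump_half:
  assumes "n \<le> 7"
  shows "\<exists>z. secures p 0 (z + 1) (n - 1) (total / 2 - p z)"
proof (rule ccontr)
  assume "\<not> ?thesis"
  then obtain c where "minimal_cut (total / 2) c" using cut_or_zero_jump[of "total / 2"] by auto
  then obtain g L1 L2 L3 where c: "minimal_cut (total / 2) (g, L1, L2, L3)" by (metis prod_cases4)
  note c2 = minimal_cut_rotate[OF c]
  note c3 = minimal_cut_rotate[OF c2]
  have "0 < L1" "0 < L2" "0 < L3"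
    using minimal_cut_lengths(1)[OF c] minimal_cut_lengths(1)[OF c2] minimal_cut_lengths(1)[OF c3] by auto
  moreover have "n = 2 * L1 + 2 * L2 + 2 * L3 + 3" using c by (simp add: minimal_cut_def cut_def)
  ultimately show False using assms by simp
qed

lemma secures_more_jumps:
  "secures p j l r x \<Longrightarrow> j \<le> j' \<Longrightarrow> secures p j' l r x"
proof (induction p j l r x arbitrary: j' rule: secures.induct)
  case (3 p j l r x)
  have "j - 1 \<le> j' - 1" using 3 by simp
  then show ?case using 3 unfolding secures.simps by (meson order_less_le_trans)
qed (auto simp: secures.simps)

lemma one_jump_half:
  assumes "n \<le> 13"
  shows "\<exists>z. secures p 1 (z + 1) (n - 1) (total / 2 - p z)"
proof (cases "\<exists>c. minimal_cut (total / 2) c")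
  case False
  then show ?thesis using cut_or_zero_jump[of "total / 2"] secures_more_jumps[of 0 _ _ _ 1] by fastforce
next
  case True
  have short: "\<exists>z. secures p 1 (z + 1) (n - 1) (total / 2 - p z)"
    if c: "minimal_cut (total / 2) (g, 1, L2, L3)" for g L2 L3
  proof (rule blocks.one_jump_gain[OF minimal_cut_blocks[OF c]])
    have "alt_sum p (g + 1) 1 = p (g + 1)" by (simp add: alt_sum_Suc)
    \<comment> \<open>\<open>b + c + d\<close> and \<open>a + b + f\<close> are complements of light
      half circles and so exceed half of the pizza.\<close>
    then show "total / 2 \<le> p (g + 1) + blocks.rest p g 1 L2 L3"
      using minimal_cut_sums[OF c] by (simp add: min_def)
  qed (use nonneg in auto)
  from True obtain g L1 L2 L3 where c: "minimal_cut (total / 2) (g, L1, L2, L3)" by (metis prod_cases4)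
  note c2 = minimal_cut_rotate[OF c]
  note c3 = minimal_cut_rotate[OF c2]
  have "0 < L1" "0 < L2" "0 < L3"
    using minimal_cut_lengths(1)[OF c] minimal_cut_lengths(1)[OF c2] minimal_cut_lengths(1)[OF c3] by auto
  moreover have "n = 2 * L1 + 2 * L2 + 2 * L3 + 3" using c by (simp add: minimal_cut_def cut_def)
  ultimately have "L1 = 1 \<or> L2 = 1 \<or> L3 = 1" using assms by linarith
  then show ?thesis using short c c2 c3 by blast
qed

lemma two_jump_four_ninths:
  shows "\<exists>z. secures p 2 (z + 1) (n - 1) (4 / 9 * total - p z)"
proof (cases "\<exists>c. minimal_cut (4 / 9 * total) c")
  case False
  have "0 \<le> total" unfolding total_def using nonneg by (simp add: sum_nonneg)
  then show ?thesis using False cut_or_zero_jump[of "4 / 9 * total"] secures_more_jumps[of 0 _ _ _ 2] by fastforce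
next
  case True
  have tot: "2 * (4 / 9 * total) \<le> total" unfolding total_def using nonneg by (simp add: sum_nonneg)
  have gain: "\<exists>z. secures p 2 (z + 1) (n - 1) (4 / 9 * total - p z)"
    if c: "minimal_cut (4 / 9 * total) (g, L1, L2, L3)"
      "4 / 9 * total \<le> alt_sum p (g + 1) L1 / 2 + alt_sum p g (Suc L1) / 4 + blocks.rest p g L1 L2 L3" for g L1 L2 L3
    by (rule blocks.two_jump_gain[OF minimal_cut_blocks[OF c(1)]])
      (use minimal_cut_lengths[OF c(1) tot] nonneg c(2) in auto)
  from True obtain g L1 L2 L3 where c: "minimal_cut (4 / 9 * total) (g, L1, L2, L3)" by (metis prod_cases4)
  note c2 = minimal_cut_rotate[OF c]
  note c3 = minimal_cut_rotate[OF c2]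
  have nL: "n = 2 * L1 + 2 * L2 + 2 * L3 + 3" using c by (simp add: minimal_cut_def cut_def)
  have eq: "g + 2 * L1 + 1 + 1 = g + 2 * L1 + 2"
    "g + 2 * L1 + 1 + 2 * L2 + 1 = g + 2 * L1 + 2 * L2 + 2"
    "g + 2 * L1 + 1 + 2 * L2 + 2 = g + 2 * L1 + 2 * L2 + 3"
    "g + 2 * L1 + 1 + 2 * L2 + 2 * L3 + 2 = g + n"
    "g + 2 * L1 + 1 + 2 * L2 + 2 * L3 + 3 = g + 1 + n"
    "g + 2 * L1 + 2 * L2 + 2 + 1 = g + 2 * L1 + 2 * L2 + 3"
    "g + 2 * L1 + 2 * L2 + 2 + 2 * L3 + 1 = g + n"
    "g + 2 * L1 + 2 * L2 + 2 + 2 * L3 + 2 = g + 1 + n"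
    "g + 2 * L1 + 2 * L2 + 2 + 2 * L3 + 2 * L1 + 2 = g + 2 * L1 + 1 + n"
    "g + 2 * L1 + 2 * L2 + 2 + 2 * L3 + 2 * L1 + 3 = g + 2 * L1 + 2 + n"
    by (simp_all add: nL)
  define b where "b = alt_sum p (g + 1) L1"
  define e where "e = alt_sum p g (Suc L1)"
  define c' where "c' = alt_sum p (g + 2 * L1 + 1) (Suc L2)"
  define f where "f = alt_sum p (g + 2 * L1 + 2) L2"
  define a where "a = alt_sum p (g + 2 * L1 + 2 * L2 + 2) (Suc L3)"
  define d where "d = alt_sum p (g + 2 * L1 + 2 * L2 + 3) L3"
  note defs = b_def[symmetric] e_def[symmetric] c'_def[symmetric] f_def[symmetric] a_def[symmetric] d_def[symmetric]
  note s = minimal_cut_sums[OF c, unfolded defs]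
  have g1: ?thesis if "4 / 9 * total \<le> b / 2 + e / 4 + min (c' + d) (f + a)"
    by (rule gain[OF c]) (use that s(5) in \<open>simp only: defs\<close>)
  have "blocks.rest p (g + 2 * L1 + 1) L2 L3 L1 = min (a + b) (d + e)"
    using minimal_cut_sums(5)[OF c2] by (simp only: eq alt_sum_per defs)
  then have g2: ?thesis if "4 / 9 * total \<le> f / 2 + c' / 4 + min (a + b) (d + e)"
    using gain[OF c2] that by (simp only: eq alt_sum_per defs)
  have "blocks.rest p (g + 2 * L1 + 2 * L2 + 2) L3 L1 L2 = min (e + f) (b + c')"
    using minimal_cut_sums(5)[OF c3] by (simp only: eq alt_sum_per defs)
  then have g3: ?thesis if "4 / 9 * total \<le> d / 2 + a / 4 + min (e + f) (b + c')"
    using gain[OF c3] that by (simp only: eq alt_sum_per defs)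
  have nn: "0 \<le> a" "0 \<le> b" "0 \<le> c'" "0 \<le> d" "0 \<le> e" "0 \<le> f"
    unfolding a_def b_def c'_def d_def e_def f_def using alt_sum_nonneg[of p] nonneg by auto
  \<comment> \<open>Suppose all three blocks fall short. Whichever term attains each minimum, the
    resulting linear inequalities contradict the bounds on the three light half circles.\<close>
  have "4 / 9 * total \<le> b / 2 + e / 4 + min (c' + d) (f + a) \<or>
     4 / 9 * total \<le> f / 2 + c' / 4 + min (a + b) (d + e) \<or>
     4 / 9 * total \<le> d / 2 + a / 4 + min (e + f) (b + c')"
  proof (rule ccontr)
    assume neg: "\<not> ?thesis"
    then show False using s(1-4) nn by (auto simp: min_def split: if_splits)
  qed
  then show ?thesis using g1 g2 g3 by blast
qed

end

section \<open>Lower bounds for all circles\<close>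

lemma secures_mono: "secures p j l r x \<Longrightarrow> y \<le> x \<Longrightarrow> secures p j l r y"
proof (induction p j l r x arbitrary: y rule: secures.induct)
  case (3 p j l r x)
  have "y - c \<le> x - c" for c using 3 by simp
  then show ?case using 3 unfolding secures.simps by meson
qed (auto simp: secures.simps)

text \<open>Only the weights seen from the start of the arc matter; this allows the first slice to
  be reduced modulo \<open>n\<close>.\<close>

lemma secures_shift:
  assumes "\<And>k. p (l + k) = p (l' + k)"
  shows "secures p j l r x \<longleftrightarrow> secures p j l' r x"
  using assms
proof (induction r arbitrary: l l' j x rule: less_induct)
  case (less r)
  show ?case
  proof (cases "r < 2")
    case True
    then have "r = 0 \<or> r = Suc 0" by auto
    then show ?thesis by (auto simp: secures.simps)
  next
    case False
    then obtain r' where r: "r = Suc (Suc r')" by (metis add_2_eq_Suc le_Suc_ex not_less)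
    have sh: "p (l + i + k) = p (l' + i + k)" for i k
      using less.prems[of "i + k"] by (simp add: add.assoc)
    have "secures p j (l + i) r' x = secures p j (l' + i) r' x" for i j x
      by (rule less.IH) (use sh r in auto)
    from this[of _ 0] this[of _ 1] this[of _ 2] show ?thesis
      using less.prems[of 0] less.prems[of 1] less.prems[of r'] less.prems[of "Suc r'"]
      by (simp add: r secures.simps)
  qed
qed

lemma strategy_if_secures:
  fixes P :: "nat \<Rightarrow> real"
  assumes "n \<ge> 1" and "\<exists>z. secures (\<lambda>k. P (k mod n)) J (z + 1) (n - 1) (G - P (z mod n))"
  shows "\<exists>s. jump_strategy n J s \<and> has_gain n P s G"
proof -
  obtain z where z: "secures (\<lambda>k. P (k mod n)) J (z + 1) (n - 1) (G - P (z mod n))"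
    using assms(2) by blast
  have "P ((z + 1 + k) mod n) = P ((z mod n + 1 + k) mod n)" for k
    using mod_add_left_eq[of z n "1 + k"] by (simp add: add.assoc)
  then have "secures (\<lambda>k. P (k mod n)) J (z mod n + 1) (n - 1) (G - P (z mod n))"
    using z secures_shift[of "\<lambda>k. P (k mod n)" "z + 1" "z mod n + 1"] by blast
  then show ?thesis using assms(1) by (intro secures_strategy) auto
qed

lemma even_half:
  assumes "even n" "n \<ge> 1"
  shows "\<exists>s. jump_strategy n 0 s \<and> has_gain n P s (1 / 2 * pizza_size n P)"
proof (rule strategy_if_secures)
  let ?p = "\<lambda>k. P (k mod n)"
  obtain m where n: "n = Suc (Suc (2 * m))"
    using assms by (metis evenE mult_Suc_right add_2_eq_Suc not_one_le_zero old.nat.exhaust mult_0_right)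
  have "(\<Sum>k<2 * j. ?p k) = alt_sum ?p 0 j + alt_sum ?p 1 j" for j
    by (induction j) (simp_all add: alt_sum_Suc)
  from this[of "Suc m"] have "pizza_size n P = alt_sum ?p 0 (Suc m) + alt_sum ?p 1 (Suc m)"
    by (simp add: pizza_size_def n)
  then obtain z where z: "z < 2" "1 / 2 * pizza_size n P \<le> alt_sum ?p z (Suc m)"
    by (cases "alt_sum ?p 0 (Suc m) \<le> alt_sum ?p 1 (Suc m)") (force intro: that[of 1] that[of 0])+
  \<comment> \<open>After \<open>z\<close> an arc of odd length remains, on which shifting keeps
    Alice on the colour of \<open>z\<close>.\<close>
  have "secures ?p 0 (z + 1) (n - 1) (alt_sum ?p (z + 1 + 1) m)"
    using secures_follow_odd[of ?p 0 "z + 1" m] by (simp add: n)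
  moreover have "z + 1 + 1 = z + 2" by simp
  then have "1 / 2 * pizza_size n P - P (z mod n) \<le> alt_sum ?p (z + 1 + 1) m"
    using z(2) alt_sum_head[of ?p z m] by (simp only:)
  ultimately show "\<exists>z. secures ?p 0 (z + 1) (n - 1) (1 / 2 * pizza_size n P - P (z mod n))"
    using secures_mono by blast
qed (use assms in simp)

lemma odd_gains:
  assumes P: "cutting n P" and n: "odd n"
  shows "n \<le> 7 \<Longrightarrow> \<exists>s. jump_strategy n 0 s \<and> has_gain n P s (1 / 2 * pizza_size n P)"
    and "n \<le> 13 \<Longrightarrow> \<exists>s. jump_strategy n 1 s \<and> has_gain n P s (1 / 2 * pizza_size n P)"
    and "\<exists>s. jump_strategy n 2 s \<and> has_gain n P s (4 / 9 * pizza_size n P)"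
proof -
  obtain m where m: "n = 2 * m + 1" using n by (rule oddE)
  interpret odd_circle "\<lambda>k. P (k mod n)" n m
  proof
    show "P ((k + n) mod n) = P (k mod n)" for k by simp
    show "0 \<le> P (k mod n)" for k using P m by (simp add: cutting_def)
  qed (rule m)
  have t: "total = pizza_size n P" unfolding total_def pizza_size_def by (intro sum.cong) auto
  have n1: "n \<ge> 1" using m by simp
  show "n \<le> 7 \<Longrightarrow> \<exists>s. jump_strategy n 0 s \<and> has_gain n P s (1 / 2 * pizza_size n P)"
    using strategy_if_secures[OF n1 zero_jump_half] by (simp add: t)
  show "n \<le> 13 \<Longrightarrow> \<exists>s. jump_strategy n 1 s \<and> has_gain n P s (1 / 2 * pizza_size n P)"
    using strategy_if_secures[OF n1 one_jump_half] by (simp add: t)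
  show "\<exists>s. jump_strategy n 2 s \<and> has_gain n P s (4 / 9 * pizza_size n P)"
    using strategy_if_secures[OF n1 two_jump_four_ninths] by (simp add: t)
qed

lemma single_slice:
  "\<exists>s. jump_strategy 1 0 s \<and> has_gain 1 P s (1 * pizza_size 1 P)"
  by (rule strategy_if_secures, simp, rule exI[of _ 0]) (simp add: secures.simps pizza_size_def)

section \<open>Upper bounds\<close>

lemma guaranteed_le:
  assumes "cutting n P" and x: "x \<in> guaranteed n"
    and "\<And>s. alice_strategy n s \<Longrightarrow> \<exists>h\<in>outcomes n s. alice_total P h \<le> G"
  shows "x * pizza_size n P \<le> G"
proof -
  obtain s where "alice_strategy n s" "has_gain n P s (x * pizza_size n P)"
    using assms(1) x unfolding guaranteed_def by blast
  then show ?thesis using assms(3)[of s] unfolding has_gain_def by force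
qed

lemma guaranteed_le_half:
  assumes n: "n \<ge> 2" and x: "x \<in> guaranteed n"
  shows "x \<le> 1 / 2"
proof -
  define P where "P = (\<lambda>i::nat. if i < 2 then 1 else (0::real))"
  \<comment> \<open>Once Alice holds a unit slice, the recorded membership ensures that Bob can take
    its partner if that is still free.\<close>
  define Q where "Q h \<longleftrightarrow> alice_total P h = 0 \<or> alice_total P h = 1 \<and> (0 \<in> set h \<or> 1 \<in> set h)" for h
  have "\<exists>h\<in>outcomes n s. alice_total P h \<le> 1" if s: "alice_strategy n s" for s
  proof -
    have start: "Q [z]" if "legal_move n [] z" for z
      by (auto simp: Q_def alice_total_single P_def)
    have step: "\<exists>b. legal_move n h b \<and> (\<forall>i. legal_move n (h @ [b]) i \<longrightarrow> Q (h @ [b, i]))"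
      if h: "legal_play n h" "odd (length h)" "Q h" "length h < n" for h
    proof -
      obtain b where b: "legal_move n h b" using legal_move_exists h by blast
      show ?thesis
      proof (cases "alice_total P h = 1")
        case True
        then have one: "0 \<in> set h \<or> 1 \<in> set h" using h(3) by (simp add: Q_def)
        have adj: "adjacent n 0 1" "adjacent n 1 0" using n by (auto simp: adjacent_def)
        obtain b' where "legal_move n h b'" "{0, 1} \<subseteq> set (h @ [b'])"
        proof (cases "{0, 1} \<subseteq> set h")
          case True then show ?thesis using b that by auto
        next
          case False
          show ?thesis
          proof (cases "0 \<in> set h")
            case True
            then have "legal_move n h 1" using False adj n by (auto simp: legal_move_def)
            then show ?thesis using that[of 1] True by auto
          next
            case False
            then have "1 \<in> set h" using one by simp
            then have "legal_move n h 0" using False adj n by (auto simp: legal_move_def)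
            then show ?thesis using that[of 0] \<open>1 \<in> set h\<close> by auto
          qed
        qed
        moreover have "alice_total P (h @ [b', i]) = 1"
          if "legal_move n (h @ [b']) i" "{0, 1} \<subseteq> set (h @ [b'])" for b' i
        proof -
          have "i \<notin> set (h @ [b'])" using that(1) by (simp add: legal_move_def)
          moreover have "0 \<in> set (h @ [b'])" "1 \<in> set (h @ [b'])" using that(2) by simp_all
          ultimately have "i \<noteq> 0" "i \<noteq> 1" by metis+
          then have "\<not> i < 2" by simp
          then show ?thesis using True h(2) by (simp add: alice_total_append2 P_def)
        qed
        ultimately show ?thesis using one unfolding Q_def by (intro exI[of _ b']) auto
      next
        case False
        then have "alice_total P h = 0" using h(3) by (simp add: Q_def)
        then have "Q (h @ [b, i])" for i
          using h(2) by (auto simp: Q_def alice_total_append2 P_def less_2_cases_iff)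
        then show ?thesis using b by blast
      qed
    qed
    obtain h where h: "h \<in> outcomes n s" "Q (if odd n then h else butlast h)"
      using play_from_invariant[of n s Q, OF s _ start step] n by auto
    then have "alice_total P h \<le> 1"
      using last_move_of_Bob(1)[of h P] by (auto simp: Q_def outcomes_def split: if_splits)
    then show ?thesis using h by blast
  qed
  moreover have "cutting n P" by (simp add: cutting_def P_def)
  moreover have "pizza_size n P = 2"
  proof -
    have "pizza_size n P = (\<Sum>i\<in>{..<2::nat}. 1)"
      unfolding pizza_size_def P_def by (intro sum.mono_neutral_cong_right) (use n in auto)
    then show ?thesis by simp
  qed
  ultimately show ?thesis using guaranteed_le[of n P x 1] x by simp
qed

section \<open>The cutting that bounds the gain by four ninths\<close>

definition light :: "nat \<Rightarrow> real" where
  "light i = (if i \<in> {0, 2, 12} then 2 else if i \<in> {5, 7, 10} then 1 else 0)"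

lemma alt_sum_list: "alt_sum p a k = (\<Sum>i\<leftarrow>[0..<k]. p (a + 2 * i))"
  by (simp add: alt_sum_def interv_sum_list_conv_sum_set_nat atLeast0LessThan)

lemma upts:
  "[0..<0] = []" "[0..<1] = [0]" "[0..<2] = [0, 1]" "[0..<3] = [0, 1, 2]" "[0..<4] = [0, 1, 2, 3]"
  "[0..<5] = [0, 1, 2, 3, 4]" "[0..<6] = [0, 1, 2, 3, 4, 5]" "[0..<7] = [0, 1, 2, 3, 4, 5, 6]"
  by (simp_all add: upt_rec)

text \<open>Bob's play against each first slice, uniformly in the \<open>2 * q\<close> additional
  zeros. A fact \<open>c_l_k_x\<close> concerns the arc of \<open>2 * (q + k)\<close> slices from
  \<open>l\<close> with bound \<open>x\<close>. At a leaf Bob settles for a colour; at a node he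
  takes an end that leaves Alice two weightless ends.\<close>

lemma light_concedes:
  assumes z: "z < 15 + 2 * q"
  shows "concedes (\<lambda>k. light (k mod (15 + 2 * q))) (z + 1) (2 * (q + 7)) (4 - light z)"
proof -
  define n where "n = 15 + 2 * q"
  define p where "p = (\<lambda>k. light (k mod n))"
  have p_small: "p k = light k" if "k < 15" for k
    using that by (simp add: p_def n_def)
  have p_mid: "p k = 0" if "13 \<le> k" "k < n" for k
    using that by (auto simp: p_def light_def)
  have p_wrap: "p (j + 2 * q) = (if j < 15 then 0 else light (j - 15))" if "13 \<le> j" "j < 30" for j
  proof (cases "j < 15")
    case True
    then show ?thesis using that p_mid[of "j + 2 * q"] by (simp add: n_def)
  next
    case False
    then have "j + 2 * q = (j - 15) + n" "j - 15 < n" using that by (auto simp: n_def)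
    then have "p (j + 2 * q) = light (j - 15)" unfolding p_def by (metis mod_add_self2 mod_less)
    then show ?thesis using False by simp
  qed
  \<comment> \<open>The colour consists of \<open>a\<close> terms, then \<open>q\<close> terms among
    the zeros \<open>13, \<dots>, n - 1\<close>, then \<open>c\<close> terms; the bound thus becomes
    independent of \<open>q\<close>.\<close>
  have leaf: "alt_sum p l (q + k) = (\<Sum>i\<leftarrow>[0..<a]. p (l + 2 * i)) + (\<Sum>i\<leftarrow>[0..<c]. p (l + 2 * a + 2 * i + 2 * q))"
    if "a + c = k" "13 \<le> l + 2 * a" "l + 2 * a \<le> 16" for l k a c
  proof -
    have "alt_sum p l (q + k) = alt_sum p l a + alt_sum p (l + 2 * a) (q + c)"
      by (rule alt_sum_split) (use that in auto)
    also have "alt_sum p (l + 2 * a) (q + c) = alt_sum p (l + 2 * a) q + alt_sum p (l + 2 * a + 2 * q) c"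
      by (rule alt_sum_split) auto
    also have "alt_sum p (l + 2 * a) q = 0"
      unfolding alt_sum_def by (intro sum.neutral ballI p_mid) (use that in \<open>auto simp: n_def\<close>)
    finally show ?thesis by (simp add: alt_sum_list ac_simps)
  qed
  have even_leaf: "concedes p l (2 * (q + k)) x"
    if "a + c = k" "13 \<le> l + 2 * a" "l + 2 * a \<le> 16"
      "(\<Sum>i\<leftarrow>[0..<a]. p (l + 2 * i)) + (\<Sum>i\<leftarrow>[0..<c]. p (l + 2 * a + 2 * i + 2 * q)) \<le> x" for l k x a c
    using leaf[OF that(1-3)] that(4) concedes_colour by metis
  have odd_leaf: "concedes p l (2 * (q + k)) x"
    if "a + c = k" "13 \<le> l + 1 + 2 * a" "l + 1 + 2 * a \<le> 16"
      "(\<Sum>i\<leftarrow>[0..<a]. p (l + 1 + 2 * i)) + (\<Sum>i\<leftarrow>[0..<c]. p (l + 1 + 2 * a + 2 * i + 2 * q)) \<le> x" for l k x a c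
    using leaf[OF that(1-3)] that(4) concedes_colour by metis
  have node_left: "concedes p l (2 * (q + k')) x"
    if "k' = Suc k" "p (l + 1) = 0" "p (l + 1 + 2 * k + 2 * q) = 0"
      "concedes p (l + 2) (2 * (q + k)) x" "concedes p (l + 1) (2 * (q + k)) x" for l k k' x
  proof -
    have "2 * (q + k') = Suc (Suc (2 * (q + k)))" "l + 1 + 2 * k + 2 * q = l + Suc (2 * (q + k))"
      using that(1) by auto
    then show ?thesis using that by (simp only: concedes.simps diff_zero) simp
  qed
  have node_right: "concedes p l (2 * (q + k')) x"
    if "k' = Suc k" "p l = 0" "p (l + 2 * k + 2 * q) = 0"
      "concedes p l (2 * (q + k)) x" "concedes p (l + 1) (2 * (q + k)) x" for l k k' x
  proof -
    have "2 * (q + k') = Suc (Suc (2 * (q + k)))" "l + 2 * k + 2 * q = l + 2 * (q + k)"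
      using that(1) by auto
    then show ?thesis using that by (simp only: concedes.simps diff_zero) simp
  qed
  have c_1_7_2: "concedes p 1 (2 * (q + 7)) 2"
    by (rule even_leaf[where a = 6 and c = 1]) (simp_all add: upts p_small p_wrap light_def)
  have c_2_7_4: "concedes p 2 (2 * (q + 7)) 4"
    by (rule odd_leaf[where a = 5 and c = 2]) (simp_all add: upts p_small p_wrap light_def)
  have c_9_4_2: "concedes p 9 (2 * (q + 4)) 2"
    by (rule even_leaf[where a = 2 and c = 2]) (simp_all add: upts p_small p_wrap light_def)
  have c_8_4_2: "concedes p 8 (2 * (q + 4)) 2"
    by (rule odd_leaf[where a = 2 and c = 2]) (simp_all add: upts p_small p_wrap light_def)
  have c_7_5_2: "concedes p 7 (2 * (q + 5)) 2"
    by (rule node_left[where k = 4]) (use c_9_4_2 c_8_4_2 in \<open>simp_all add: p_small p_wrap light_def\<close>)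
  have c_6_4_2: "concedes p 6 (2 * (q + 4)) 2"
    by (rule odd_leaf[where a = 3 and c = 1]) (simp_all add: upts p_small p_wrap light_def)
  have c_7_4_2: "concedes p 7 (2 * (q + 4)) 2"
    by (rule even_leaf[where a = 3 and c = 1]) (simp_all add: upts p_small p_wrap light_def)
  have c_6_5_2: "concedes p 6 (2 * (q + 5)) 2"
    by (rule node_right[where k = 4]) (use c_6_4_2 c_7_4_2 in \<open>simp_all add: p_small p_wrap light_def\<close>)
  have c_5_6_2: "concedes p 5 (2 * (q + 6)) 2"
    by (rule node_left[where k = 5]) (use c_7_5_2 c_6_5_2 in \<open>simp_all add: p_small p_wrap light_def\<close>)
  have c_4_5_2: "concedes p 4 (2 * (q + 5)) 2"
    by (rule odd_leaf[where a = 4 and c = 1]) (simp_all add: upts p_small p_wrap light_def)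
  have c_5_5_2: "concedes p 5 (2 * (q + 5)) 2"
    by (rule even_leaf[where a = 4 and c = 1]) (simp_all add: upts p_small p_wrap light_def)
  have c_4_6_2: "concedes p 4 (2 * (q + 6)) 2"
    by (rule node_right[where k = 5]) (use c_4_5_2 c_5_5_2 in \<open>simp_all add: p_small p_wrap light_def\<close>)
  have c_3_7_2: "concedes p 3 (2 * (q + 7)) 2"
    by (rule node_left[where k = 6]) (use c_5_6_2 c_4_6_2 in \<open>simp_all add: p_small p_wrap light_def\<close>)
  have c_4_7_4: "concedes p 4 (2 * (q + 7)) 4"
    by (rule even_leaf[where a = 5 and c = 2]) (simp_all add: upts p_small p_wrap light_def)
  have c_5_7_4: "concedes p 5 (2 * (q + 7)) 4"
    by (rule odd_leaf[where a = 4 and c = 3]) (simp_all add: upts p_small p_wrap light_def)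
  have c_6_7_3: "concedes p 6 (2 * (q + 7)) 3"
    by (rule even_leaf[where a = 4 and c = 3]) (simp_all add: upts p_small p_wrap light_def)
  have c_7_7_4: "concedes p 7 (2 * (q + 7)) 4"
    by (rule odd_leaf[where a = 3 and c = 4]) (simp_all add: upts p_small p_wrap light_def)
  have c_12_5_3: "concedes p 12 (2 * (q + 5)) 3"
    by (rule even_leaf[where a = 1 and c = 4]) (simp_all add: upts p_small p_wrap light_def)
  have c_11_5_3: "concedes p 11 (2 * (q + 5)) 3"
    by (rule odd_leaf[where a = 1 and c = 4]) (simp_all add: upts p_small p_wrap light_def)
  have c_10_6_3: "concedes p 10 (2 * (q + 6)) 3"
    by (rule node_left[where k = 5]) (use c_12_5_3 c_11_5_3 in \<open>simp_all add: p_small p_wrap light_def\<close>)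
  have c_9_5_3: "concedes p 9 (2 * (q + 5)) 3"
    by (rule odd_leaf[where a = 2 and c = 3]) (simp_all add: upts p_small p_wrap light_def)
  have c_10_5_3: "concedes p 10 (2 * (q + 5)) 3"
    by (rule even_leaf[where a = 2 and c = 3]) (simp_all add: upts p_small p_wrap light_def)
  have c_9_6_3: "concedes p 9 (2 * (q + 6)) 3"
    by (rule node_right[where k = 5]) (use c_9_5_3 c_10_5_3 in \<open>simp_all add: p_small p_wrap light_def\<close>)
  have c_8_7_3: "concedes p 8 (2 * (q + 7)) 3"
    by (rule node_left[where k = 6]) (use c_10_6_3 c_9_6_3 in \<open>simp_all add: p_small p_wrap light_def\<close>)
  have c_9_7_4: "concedes p 9 (2 * (q + 7)) 4"
    by (rule even_leaf[where a = 2 and c = 5]) (simp_all add: upts p_small p_wrap light_def)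
  have c_10_7_4: "concedes p 10 (2 * (q + 7)) 4"
    by (rule odd_leaf[where a = 1 and c = 6]) (simp_all add: upts p_small p_wrap light_def)
  have c_11_6_3: "concedes p 11 (2 * (q + 6)) 3"
    by (rule node_right[where k = 5]) (use c_11_5_3 c_12_5_3 in \<open>simp_all add: p_small p_wrap light_def\<close>)
  have c_14_5_3: "concedes p 14 (2 * (q + 5)) 3"
    by (rule even_leaf[where a = 0 and c = 5]) (simp_all add: upts p_small p_wrap light_def)
  have c_13_5_3: "concedes p 13 (2 * (q + 5)) 3"
    by (rule odd_leaf[where a = 0 and c = 5]) (simp_all add: upts p_small p_wrap light_def)
  have c_12_6_3: "concedes p 12 (2 * (q + 6)) 3"
    by (rule node_left[where k = 5]) (use c_14_5_3 c_13_5_3 in \<open>simp_all add: p_small p_wrap light_def\<close>)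
  have c_11_7_3: "concedes p 11 (2 * (q + 7)) 3"
    by (rule node_right[where k = 6]) (use c_11_6_3 c_12_6_3 in \<open>simp_all add: p_small p_wrap light_def\<close>)
  have c_12_7_4: "concedes p 12 (2 * (q + 7)) 4"
    by (rule even_leaf[where a = 1 and c = 6]) (simp_all add: upts p_small p_wrap light_def)
  have c_13_7_2: "concedes p 13 (2 * (q + 7)) 2"
    by (rule odd_leaf[where a = 0 and c = 7]) (simp_all add: upts p_small p_wrap light_def)
  have "concedes p (z + 1) (2 * (q + 7)) (4 - light z)"
  proof (cases "z < 13")
    case True
    then have "z \<in> set [0..<13]" by simp
    then have "z \<in> {0, 1, 2, 3, 4, 5, 6, 7, 8, 9, 10, 11, 12}" by (simp add: upt_rec numeral_eq_Suc)
    then show ?thesis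
      using c_1_7_2 c_2_7_4 c_3_7_2 c_4_7_4 c_5_7_4 c_6_7_3 c_7_7_4 c_8_7_3 c_9_7_4 c_10_7_4 c_11_7_3 c_12_7_4 c_13_7_2
      by (auto simp: light_def simp del: One_nat_def)
  next
    case False
    \<comment> \<open>If Alice starts among the trailing zeros, Bob leaves her the colour of an even
      \<open>a\<close>: it runs through zeros up to \<open>n\<close> and then, as \<open>n\<close>
      is odd, through slices of odd index, of which only 5 and 7 have weight.\<close>
    have "\<exists>a. 14 \<le> a \<and> a \<le> n + 1 \<and> even a \<and> (a = z + 1 \<or> a = z + 1 + 1)"
    proof (cases "even z")
      case True
      then have "z \<noteq> 13" "even (z + 1 + 1)" by auto
      then show ?thesis using False z by (intro exI[of _ "z + 1 + 1"]) (auto simp: n_def)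
    next
      case odd: False
      then show ?thesis using False z by (intro exI[of _ "z + 1"]) (auto simp: n_def)
    qed
    then obtain a where a: "14 \<le> a" "a \<le> n + 1" "even a" "a = z + 1 \<or> a = z + 1 + 1" by blast
    \<comment> \<open>\<open>?I c i\<close> marks the term that is slice \<open>c\<close> after the
      full turn; at most one \<open>i\<close> qualifies.\<close>
    let ?I = "\<lambda>c i. if a + 2 * i = n + c then 1 else (0::real)"
    have one: "(\<Sum>i<q + 7. ?I c i) \<le> 1" for c
    proof -
      have "(\<Sum>i<q + 7. ?I c i) = real (card {i. i < q + 7 \<and> a + 2 * i = n + c})"
        by (simp add: sum.If_cases Int_def)
      also have "card {i. i < q + 7 \<and> a + 2 * i = n + c} \<le> card {(n + c - a) div 2}"
        by (rule card_mono) auto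
      finally show ?thesis by simp
    qed
    have "p (a + 2 * i) \<le> ?I 5 i + ?I 7 i" if i: "i < q + 7" for i
    proof (cases "a + 2 * i < n")
      case True
      then show ?thesis using p_mid[of "a + 2 * i"] a by simp
    next
      case False
      define k where "k = a + 2 * i - n"
      have k: "a + 2 * i = k + n" "k < n" using False a i by (auto simp: k_def n_def)
      have "odd k"
      proof -
        have "even (k + n)" unfolding k(1)[symmetric] using a(3) by simp
        moreover have "odd n" by (simp add: n_def)
        ultimately show ?thesis by simp
      qed
      then have "light k \<le> (if k = 5 then 1 else 0) + (if k = 7 then 1 else 0)"
        using odd_pos[of k] by (auto simp: light_def)
      moreover have "p (a + 2 * i) = light k" using k by (simp add: p_def)
      ultimately show ?thesis using k by auto
    qed
    then have "alt_sum p a (q + 7) \<le> (\<Sum>i<q + 7. ?I 5 i + ?I 7 i)"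
      unfolding alt_sum_def by (intro sum_mono) auto
    also have "\<dots> \<le> 2" using one[of 5] one[of 7] by (simp add: sum.distrib)
    finally have "alt_sum p a (q + 7) \<le> 4 - light z" using False by (auto simp: light_def)
    then show ?thesis using a(4) concedes_colour by metis
  qed
  then show ?thesis unfolding p_def n_def .
qed

lemma guaranteed_le_four_ninths:
  assumes n: "odd n" "n \<ge> 15" and x: "x \<in> guaranteed n"
  shows "x \<le> 4 / 9"
proof -
  have "even (n - 15)" using n by simp
  then obtain q where "n - 15 = 2 * q" by blast
  then have q: "n = 15 + 2 * q" using n by simp
  have "\<exists>h\<in>outcomes n s. alice_total light h \<le> 4" if "alice_strategy n s" for s
  proof (rule concedes_play[OF _ that])
    fix z assume "z < n"
    have "n - 1 = 2 * (q + 7)" using q by simp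
    then show "concedes (\<lambda>k. light (k mod n)) (z + 1) (n - 1) (4 - light z)"
      using light_concedes[of z q] \<open>z < n\<close> by (simp only: q)
  qed (use n in simp)
  moreover have "cutting n light" by (simp add: cutting_def light_def)
  moreover have "pizza_size n light = 9"
  proof -
    have "pizza_size n light = (\<Sum>i\<in>{0, 2, 5, 7, 10, 12}. light i)"
      unfolding pizza_size_def by (intro sum.mono_neutral_right) (use n in \<open>auto simp: light_def\<close>)
    then show ?thesis by (simp add: light_def)
  qed
  ultimately show ?thesis using guaranteed_le[of n light x 4] x by simp
qed

section \<open>The value and the number of jumps for each \<open>n\<close>\<close>

theorem theorem2:
  fixes n :: nat
  assumes "n \<ge> 1"
  shows "pizza_gain n \<in> guaranteed n \<and> (\<forall>x\<in>guaranteed n. x \<le> pizza_gain n)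
    \<and> pizza_gain n = (if n = 1 then 1 else if odd n \<and> n \<ge> 15 then 4/9 else 1/2)
    \<and> (\<forall>P. cutting n P \<longrightarrow>
         (even n \<or> n \<le> 7 \<longrightarrow>
            (\<exists>s. jump_strategy n 0 s \<and> has_gain n P s (pizza_gain n * pizza_size n P)))
       \<and> (n \<in> {9, 11, 13} \<longrightarrow>
            (\<exists>s. jump_strategy n 1 s \<and> has_gain n P s (pizza_gain n * pizza_size n P)))
       \<and> (odd n \<and> n \<ge> 15 \<longrightarrow>
            (\<exists>s. jump_strategy n 2 s \<and> has_gain n P s (pizza_gain n * pizza_size n P))))"
proof -
  define v :: real where "v = (if n = 1 then 1 else if odd n \<and> n \<ge> 15 then 4/9 else 1/2)"
  have s0: "\<exists>s. jump_strategy n 0 s \<and> has_gain n P s (v * pizza_size n P)"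
    if "cutting n P" "even n \<or> n \<le> 7" for P
    using that assms single_slice[of P] even_half[of n P] odd_gains(1)[of n P]
    by (cases "n = 1"; cases "even n") (auto simp: v_def)
  have s1: "\<exists>s. jump_strategy n 1 s \<and> has_gain n P s (v * pizza_size n P)"
    if "cutting n P" "n \<in> {9, 11, 13}" for P
    using that odd_gains(2)[of n P] by (auto simp: v_def)
  have s2: "\<exists>s. jump_strategy n 2 s \<and> has_gain n P s (v * pizza_size n P)"
    if "cutting n P" "odd n \<and> n \<ge> 15" for P
    using that odd_gains(3)[of n P] by (auto simp: v_def)
  have range: "(even n \<or> n \<le> 7) \<or> n \<in> {9, 11, 13} \<or> odd n \<and> n \<ge> 15" by auto presburger
  have mem: "v \<in> guaranteed n"
    unfolding guaranteed_def
  proof (intro CollectI conjI allI impI)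
    show "v \<in> {0..1}" by (simp add: v_def)
    fix P assume "cutting n P"
    then show "\<exists>s. alice_strategy n s \<and> has_gain n P s (v * pizza_size n P)"
      using s0 s1 s2 range unfolding jump_strategy_def by meson
  qed
  have max: "x \<le> v" if "x \<in> guaranteed n" for x
  proof -
    have "x \<le> 1" using that by (simp add: guaranteed_def)
    then show ?thesis
      using that assms guaranteed_le_half[of n x] guaranteed_le_four_ninths[of n x] by (simp add: v_def)
  qed
  have gain: "pizza_gain n = v"
    unfolding pizza_gain_def by (rule Greatest_equality) (use mem max in auto)
  show ?thesis unfolding gain using mem max s0 s1 s2 v_def by blast
qed

end
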